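(* Let $d\ge5$, let $0<\gamma<d-2$, put $p_N=N^{-\gamma}$, and fix $q\in\mathbb N$. For $\lambda\in\mathbb N$, let $G^{(q)}_{\lambda,N}$ be the directed graph with vertex set $Q_N$ and edge set $$E^{(q)}_{\lambda,N}=\{(\mathbf x,\mathbf y)\in Q_N\times Q_N:\ \mathbf y-\mathbf x\in qS_\lambda\}.$$ There are constants $c_0=c_0(d,q)>0$, $c_1=c_1(d,q)>0$ and $c_2=c_2(d,q)>0$ such that, uniformly for all integers $\lambda$ satisfying $$c_1p_N^{-2/(d-2)}\le\lambda\le c_2N^2,$$ we have $|S_\lambda|\simeq_d\lambda^{d/2-1}$, $|E^{(q)}_{\lambda,N}|\simeq_{d,q}|Q_N||S_\lambda|$, and $p_N|S_\lambda|\ge1$. Furthermore, for every $p_N\le\theta\le1$, if $Q_{N,\theta}$ denotes the binomial random subset of $Q_N$ with retention probability $\theta$, then $$\mathbb E\sum_{\mathbf x\in Q_N}\deg_{G^{(q)}_{\lambda,N}}(\mathbf x,Q_{N,\theta})^2\ \le\ c_0\,\theta^2\,\frac{|E^{(q)}_{\lambda,N}|^2}{|Q_N|}.$$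
   Context: $Q_N=[-N,N]^d\cap\mathbb Z^d$; $S_\lambda=\{\mathbf v\in\mathbb Z^d:|\mathbf v|^2=\lambda\}$ (Euclidean norm); $qS_\lambda=\{q\mathbf v:\mathbf v\in S_\lambda\}$. For a directed graph $G$ on $Q_N$, $\mathbf x\in Q_N$ and $U\subseteq Q_N$, $\deg_G(\mathbf x,U)$ is the out-degree of $\mathbf x$ into $U$, i.e. the number of $\mathbf y\in U$ such that $(\mathbf x,\mathbf y)$ is an edge of $G$. The binomial random subset with retention probability $\theta$ retains each point independently with probability $\theta$. The notation $a\simeq_\kappa b$ means $C^{-1}b\le a\le Cb$ for some constant $C>0$ depending only on $\kappa$. *)

theory Defs
  imports "HOL-Probability.Probability" "Graph_Theory.Pair_Digraph"
begin

definition int_lattice :: "(real ^ 'd) set" where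
  "int_lattice = {v. \<forall>i. v $ i \<in> \<int>}"

definition lattice_cube :: "nat \<Rightarrow> (real ^ 'd) set" where
  "lattice_cube N = cbox (\<chi> i. - real N) (\<chi> i. real N) \<inter> int_lattice"

definition lattice_sphere :: "nat \<Rightarrow> (real ^ 'd) set" where
  "lattice_sphere lam = {v \<in> int_lattice. (norm v)\<^sup>2 = real lam}"

definition dist_graph :: "nat \<Rightarrow> nat \<Rightarrow> nat \<Rightarrow> (real ^ 'd) pair_pre_digraph" where
  "dist_graph q lam N = \<lparr> pverts = lattice_cube N,
     parcs = {(x, y) \<in> lattice_cube N \<times> lattice_cube N.
                y - x \<in> (\<lambda>v. real q *\<^sub>R v) ` lattice_sphere lam} \<rparr>"

definition deg_into :: "'a pair_pre_digraph \<Rightarrow> 'a \<Rightarrow> 'a set \<Rightarrow> nat" where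
  "deg_into G x U = card {y \<in> U. (x, y) \<in> parcs G}"

definition binomial_subset :: "'a set \<Rightarrow> real \<Rightarrow> 'a set pmf" where
  "binomial_subset A \<theta> =
     map_pmf (\<lambda>retained. {x \<in> A. retained x}) (Pi_pmf A False (\<lambda>_. bernoulli_pmf \<theta>))"

definition comparable_within :: "real \<Rightarrow> real \<Rightarrow> real \<Rightarrow> bool" where
  "comparable_within C a b \<longleftrightarrow> inverse C * b \<le> a \<and> a \<le> C * b"

definition retention_prob :: "real \<Rightarrow> nat \<Rightarrow> real" where
  "retention_prob \<gamma> N = real N powr (- \<gamma>)"

end

theory Submission
  imports Defs
begin

text \<open>
  Everything reduces to the order of magnitude $n^{d/2-1}$ of the number $r_d(n)$ of representations
  of $n \ge 1$ by $d \ge 5$ squares, uniformly in $n$ (\<open>card_sq_reps_bounds\<close>). Instead of the circle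
  method, the proof uses an exact formula for four squares and sums over the remaining ones.

  \<^emph>\<open>Four squares.\<close> Jacobi's formula $r_4(m) = 8\sigma(m)$ for odd $m$, and the bound $r_4 \le 24\sigma$ in
  general, follow from an elementary identity. By symmetry between the coordinates, the numbers of
  representations by four odd squares satisfy a linear recursion with a unique solution up to
  scaling (\<open>sq_reps_recursion\<close>). The function $\sigma$ satisfies the same recursion
  (\<open>divisor_sum_recursion\<close>): this is a statement about a cubic polynomial summed over the
  solutions of $x^2 + 4yz = N$ with positive $y$ and $z$, and it holds because the polynomial, once
  symmetrised, is a product of three linear factors that changes sign under an involution of the
  solutions (\<open>disc_triples_cubic_sum\<close>). Comparing parities passes from odd squares to all squares.

  \<^emph>\<open>Five squares and more.\<close> One has $r_5(n) = \sum_x r_4(n - x^2)$. For the lower bound it is enough to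
  use those $x$ for which $n - x^2$ is odd and at least $n/2$. For the upper bound, $\sigma(m)/m$ is the
  sum of $1/e$ over the divisors $e$ of $m$, so the average of $\sigma(n - x^2)/n$ over $x$ is governed by
  the number of square roots of $n$ modulo $e$. Factoring $(x - r)(x + r)$ for one such root $r$ bounds
  the average by a convergent double series, at most $\zeta(3/2)^2$ up to a constant, for every $n$
  (\<open>sum_card_square_roots_mod_le\<close>). Each further square contributes a factor of order $\sqrt{n}$.

  \<^emph>\<open>The graph.\<close> Out-degrees are at most $|S_\lambda|$. If $q\sqrt{\lambda} \le N$, every vector of the sphere
  occurs on a positive proportion of the vertices, so $|E|$ is comparable to $|Q_N||S_\lambda|$
  (\<open>card_edges_ge\<close>). The lower bound on $\lambda$ ensures that $p_N|S_\lambda| \ge 1$, if its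
  constant is large enough. The number of neighbours retained with probability $\theta$ has second
  moment at most $\theta^2D^2 + \theta D$ with $D = |S_\lambda|$, and $\theta D \ge 1$ makes the first term dominate
  (\<open>expectation_sum_deg_square_le\<close>); summing over the vertices gives the claim.
\<close>

section \<open>Representations by squares\<close>

text \<open>Lists make it possible to peel off one square at a time; the set \<open>A\<close> of admissible terms will
  be either all integers or the odd integers.\<close>

definition sq_reps :: "int set \<Rightarrow> nat \<Rightarrow> int \<Rightarrow> int list set" where
  "sq_reps A k n = {xs. set xs \<subseteq> A \<and> length xs = k \<and> (\<Sum>x\<leftarrow>xs. x\<^sup>2) = n}"

lemma abs_le_square_int: "\<bar>x\<bar> \<le> x\<^sup>2" for x :: int
proof (cases "x = 0")
  case False
  then have "\<bar>x\<bar> * 1 \<le> \<bar>x\<bar> * \<bar>x\<bar>" by (intro mult_left_mono) auto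
  then show ?thesis by (simp add: power2_eq_square flip: abs_mult)
qed simp

lemma bounded_square_subset: "x\<^sup>2 \<le> n \<Longrightarrow> x \<in> {-n..n}" for x n :: int
  using abs_le_square_int[of x] by auto

lemma finite_bounded_squares [simp]: "finite {x::int. P x \<and> x\<^sup>2 \<le> n}"
  by (rule finite_subset[of _ "{-n..n}"]) (use bounded_square_subset in auto)

lemma finite_sq_reps [simp]: "finite (sq_reps A k n)"
proof (rule finite_subset[OF _ finite_lists_length_eq[of "{-n..n}" k]])
  have "x\<^sup>2 \<le> (\<Sum>x\<leftarrow>xs. x\<^sup>2)" if "x \<in> set xs" for x :: int and xs
    using that by (intro member_le_sum_list) auto
  then show "sq_reps A k n \<subseteq> {xs. set xs \<subseteq> {-n..n} \<and> length xs = k}"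
    using bounded_square_subset unfolding sq_reps_def by blast
qed simp

lemma sum_list_squares_nonneg: "(\<Sum>x\<leftarrow>xs. x\<^sup>2) \<ge> (0::int)"
  by (induction xs) auto

text \<open>Grouping representations by their first term \<open>x\<close> is the step from $k + 1$ squares to $k$; the
  weight \<open>f\<close> is needed for the recursion below.\<close>

lemma sum_hd_sq_reps:
  fixes f :: "int \<Rightarrow> int"
  shows "(\<Sum>xs\<in>sq_reps A (Suc k) n. f (hd xs)) =
    (\<Sum>x | x \<in> A \<and> x\<^sup>2 \<le> n. f x * int (card (sq_reps A k (n - x\<^sup>2))))"
proof -
  have eq: "sq_reps A (Suc k) n = (\<Union>x\<in>{x. x \<in> A \<and> x\<^sup>2 \<le> n}. Cons x ` sq_reps A k (n - x\<^sup>2))"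
  proof (intro equalityI subsetI)
    fix xs assume "xs \<in> sq_reps A (Suc k) n"
    then obtain x ys where "xs = x # ys" "x \<in> A" "ys \<in> sq_reps A k (n - x\<^sup>2)" "x\<^sup>2 + (\<Sum>x\<leftarrow>ys. x\<^sup>2) = n"
      by (cases xs) (auto simp: sq_reps_def)
    moreover from this have "x\<^sup>2 \<le> n" using sum_list_squares_nonneg[of ys] by linarith
    ultimately show "xs \<in> (\<Union>x\<in>{x. x \<in> A \<and> x\<^sup>2 \<le> n}. Cons x ` sq_reps A k (n - x\<^sup>2))" by auto
  qed (auto simp: sq_reps_def)
  show ?thesis unfolding eq
    by (subst sum.UNION_disjoint) (auto simp: sum.reindex mult.commute)
qed

lemma card_sq_reps_Suc:
  "card (sq_reps A (Suc k) n) = (\<Sum>x | x \<in> A \<and> x\<^sup>2 \<le> n. card (sq_reps A k (n - x\<^sup>2)))"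
  using sum_hd_sq_reps[of "\<lambda>_. 1" A k n] by (simp flip: of_nat_sum)

text \<open>Summing \<open>n - (k + 1) * (hd xs)\<^sup>2\<close> over the representations of \<open>n\<close> by $k + 1$ squares gives $0$,
  because by symmetry every term has the same average square, namely $n/(k+1)$. For theta series
  this is the identity $\theta\,(\theta^k)' = k\,\theta^k\theta'$. The recursion determines the number
  of representations by $k$ squares from its first non-zero value, so that an explicit
  formula can be verified by checking that it satisfies the same recursion.\<close>

lemma sq_reps_recursion:
  "(\<Sum>x | x \<in> A \<and> x\<^sup>2 \<le> n. (n - int (Suc k) * x\<^sup>2) * int (card (sq_reps A k (n - x\<^sup>2)))) = 0"
proof -
  define R where "R = sq_reps A (Suc k) n"
  \<comment> \<open>Rotating the list brings its \<open>i\<close>-th term to the front.\<close>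
  have rot: "(\<Sum>xs\<in>R. (xs ! i)\<^sup>2) = (\<Sum>xs\<in>R. (hd xs)\<^sup>2)" if "i < Suc k" for i
  proof (rule sum.reindex_bij_witness[where i = "rotate (Suc k - i)" and j = "rotate i"])
    fix xs assume "xs \<in> R"
    then have len: "length xs = Suc k" by (simp add: R_def sq_reps_def)
    show "rotate (Suc k - i) (rotate i xs) = xs" "rotate i (rotate (Suc k - i) xs) = xs"
      using len that rotate_id[of "Suc k" xs] by (simp_all add: rotate_rotate del: rotate_Suc)
    have *: "rotate j xs \<in> R" for j
    proof -
      have "(\<Sum>x\<leftarrow>rotate j xs. x\<^sup>2) = (\<Sum>x\<leftarrow>xs. x\<^sup>2)"
        by (metis append_take_drop_id map_append rotate_drop_take sum_list_append add.commute)
      with \<open>xs \<in> R\<close> show ?thesis by (simp add: R_def sq_reps_def)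
    qed
    show "rotate i xs \<in> R" "rotate (Suc k - i) xs \<in> R" using * by auto
    show "(hd (rotate i xs))\<^sup>2 = (xs ! i)\<^sup>2"
      using len that by (subst hd_rotate_conv_nth) auto
  qed
  have "(\<Sum>xs\<in>R. n) = (\<Sum>xs\<in>R. \<Sum>i<Suc k. (xs ! i)\<^sup>2)"
    by (rule sum.cong) (auto simp: R_def sq_reps_def sum_list_sum_nth atLeast0LessThan simp del: sum.lessThan_Suc)
  also have "\<dots> = (\<Sum>i<Suc k. \<Sum>xs\<in>R. (xs ! i)\<^sup>2)" by (rule sum.swap)
  also have "\<dots> = (\<Sum>i<Suc k. \<Sum>xs\<in>R. (hd xs)\<^sup>2)" by (rule sum.cong) (use rot in auto)
  also have "\<dots> = (\<Sum>xs\<in>R. int (Suc k) * (hd xs)\<^sup>2)" by (simp add: sum_distrib_left)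
  finally have "(\<Sum>xs\<in>R. n - int (Suc k) * (hd xs)\<^sup>2) = 0" by (simp only: sum_subtractf)
  then show ?thesis unfolding R_def by (subst (asm) sum_hd_sq_reps)
qed

section \<open>A Liouville identity on the surface $x^2 + 4yz = N$\<close>

text \<open>These triples are the binary quadratic forms $-yX^2 + xXY + zY^2$ of discriminant \<open>N\<close> that are
  negative at $(1,0)$ and positive at $(0,1)$.\<close>

definition disc_triples :: "int \<Rightarrow> (int \<times> int \<times> int) set" where
  "disc_triples N = {(x, y, z). x\<^sup>2 + 4 * y * z = N \<and> 0 < y \<and> 0 < z}"

lemma finite_disc_triples [simp]: "finite (disc_triples N)"
proof (rule finite_subset)
  show "disc_triples N \<subseteq> {-N..N} \<times> {0..N} \<times> {0..N}"
  proof
    fix t assume "t \<in> disc_triples N"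
    moreover obtain x y z where t: "t = (x, y, z)" by (cases t)
    ultimately have *: "x\<^sup>2 + 4 * y * z = N" "0 < y" "0 < z" by (auto simp: disc_triples_def)
    have "y * 1 \<le> y * z" "1 * z \<le> y * z" using * by (intro mult_mono; simp)+
    moreover have "x\<^sup>2 \<ge> 0" by simp
    ultimately have "x\<^sup>2 \<le> N" "y \<le> N" "z \<le> N"
      using * unfolding mult.assoc by linarith+
    then show "t \<in> {-N..N} \<times> {0..N} \<times> {0..N}"
      using t * bounded_square_subset[of x N] by auto
  qed
qed auto

lemma square_mod_8_not_5: "x\<^sup>2 mod 8 \<noteq> 5" for x :: int
proof -
  have "x mod 8 \<in> {0..<8}" by simp
  then have "x mod 8 \<in> {0,1,2,3,4,5,6,7}" by auto
  then have "(x mod 8)\<^sup>2 mod 8 \<noteq> 5" by auto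
  then show ?thesis by (simp add: power_mod)
qed

lemma sum_antisymmetric_involution:
  fixes f :: "'a \<Rightarrow> int"
  assumes "\<And>t. t \<in> B \<Longrightarrow> h t \<in> B" "\<And>t. t \<in> B \<Longrightarrow> h (h t) = t" "\<And>t. t \<in> B \<Longrightarrow> f (h t) = - f t"
  shows "sum f B = 0"
proof -
  have "sum f B = (\<Sum>t\<in>B. - f t)"
    by (rule sum.reindex_bij_witness[of _ h h]) (use assms in auto)
  then show ?thesis by (simp add: sum_negf)
qed

text \<open>Symmetrising the summand by the swap of \<open>y\<close> and \<open>z\<close> and adding the term $-x(y^2 - z^2)$, which
  is odd in \<open>x\<close> and therefore sums to zero, turns twice the sum into the sum of the product
  $(y+z)(x+z)(x-y)$. The triples split according to the sign of $z + x - y$, which is the value of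
  the form at $(1,1)$; it cannot vanish because \<open>N\<close> is not a square. On each part the product
  changes sign under an involution that comes from an automorphism of the form $x^2 + 4yz$, as in
  Zagier's proof of the two-square theorem: on the first part it exchanges the factors $y + z$ and
  $x + z$ and negates $x - y$.\<close>

lemma disc_triples_cubic_sum:
  assumes N: "N mod 8 = 5"
  shows "(\<Sum>(x, y, z)\<in>disc_triples N. z * (x\<^sup>2 - y * z)) = 0"
proof -
  let ?D = "disc_triples N"
  let ?P = "{(x, y, z) \<in> ?D. y < z + x}" and ?M = "{(x, y, z) \<in> ?D. z + x < y}"
  let ?E = "\<lambda>(x::int, y::int, z::int). (y + z) * (x + z) * (x - y)"
  have "sum ?E ?P = 0"
    by (rule sum_antisymmetric_involution[of _ "\<lambda>(x, y, z). (2 * y - x, y, z + x - y)"])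
      (auto simp: disc_triples_def power2_eq_square algebra_simps)
  moreover have "sum ?E ?M = 0"
    by (rule sum_antisymmetric_involution[of _ "\<lambda>(x, y, z). (- x - 2 * z, y - x - z, z)"])
      (auto simp: disc_triples_def power2_eq_square algebra_simps)
  moreover have "?D = ?P \<union> ?M"
  proof -
    \<comment> \<open>On the excluded line, \<open>N\<close> would be the square of \<open>x + 2 * z\<close>.\<close>
    have "z + x \<noteq> y" if "(x, y, z) \<in> ?D" for x y z
    proof
      assume "z + x = y"
      then have "N = (x + 2 * z)\<^sup>2" using that
        by (auto simp: disc_triples_def power2_eq_square algebra_simps)
      then show False using N square_mod_8_not_5 by metis
    qed
    then show ?thesis by force
  qed
  moreover have "sum ?E (?P \<union> ?M) = sum ?E ?P + sum ?E ?M"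
    by (rule sum.union_disjoint) (auto intro: finite_subset[OF _ finite_disc_triples])
  ultimately have E: "sum ?E ?D = 0" by simp
  have odd: "(\<Sum>(x, y, z)\<in>?D. x * (y\<^sup>2 - z\<^sup>2)) = 0"
    by (rule sum_antisymmetric_involution[of _ "\<lambda>(x, y, z). (- x, y, z)"])
      (auto simp: disc_triples_def algebra_simps)
  have swap: "(\<Sum>(x, y, z)\<in>?D. y * (x\<^sup>2 - y * z)) = (\<Sum>(x, y, z)\<in>?D. z * (x\<^sup>2 - y * z))"
    by (rule sum.reindex_bij_witness[of _ "\<lambda>(x, y, z). (x, z, y)" "\<lambda>(x, y, z). (x, z, y)"])
      (auto simp: disc_triples_def algebra_simps)
  have "sum ?E ?D = (\<Sum>(x, y, z)\<in>?D. y * (x\<^sup>2 - y * z)) + (\<Sum>(x, y, z)\<in>?D. z * (x\<^sup>2 - y * z))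
      - (\<Sum>(x, y, z)\<in>?D. x * (y\<^sup>2 - z\<^sup>2))"
    unfolding sum.distrib[symmetric] sum_subtractf[symmetric]
    by (rule sum.cong) (auto simp: power2_eq_square algebra_simps)
  with E odd swap show ?thesis by simp
qed

text \<open>The arithmetic function usually written $\sigma$.\<close>

definition divisor_sum :: "int \<Rightarrow> int" where
  "divisor_sum n = (\<Sum>d | 0 < d \<and> d dvd n. d)"

lemma finite_positive_divisors: "n \<noteq> 0 \<Longrightarrow> finite {d::int. 0 < d \<and> d dvd n}"
  by (rule finite_subset[of _ "{0..\<bar>n\<bar>}"]) (auto dest: dvd_imp_le_int)

text \<open>For fixed \<open>x\<close>, the values of \<open>z\<close> with $x^2 + 4yz = N$ are the divisors of $(N - x^2)/4$, and
  $-4z(x^2 - yz) = (N - 5x^2)z$ on this surface. So the identity above says that $\sigma$ obeys the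
  recursion of \<open>sq_reps_recursion\<close> for four odd squares.\<close>

lemma divisor_sum_recursion:
  assumes N: "N mod 8 = 5"
  shows "(\<Sum>x | odd x \<and> x\<^sup>2 \<le> N. (N - 5 * x\<^sup>2) * divisor_sum ((N - x\<^sup>2) div 4)) = 0"
proof -
  let ?X = "{x. odd x \<and> x\<^sup>2 \<le> N}"
  let ?Z = "\<lambda>x. {z. 0 < z \<and> z dvd ((N - x\<^sup>2) div 4)}"
  have four: "4 dvd N - x\<^sup>2 \<and> x\<^sup>2 < N" if "x \<in> ?X" for x
  proof -
    from that obtain j where "x = 2 * j + 1" by (auto elim: oddE)
    then have x: "x\<^sup>2 = 4 * (j\<^sup>2 + j) + 1" by (simp add: power2_eq_square algebra_simps)
    have "4 dvd N - 1" using N by presburger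
    then have "4 dvd (N - 1) - 4 * (j\<^sup>2 + j)" by (rule dvd_diff) simp
    moreover have "(N - 1) - 4 * (j\<^sup>2 + j) = N - x\<^sup>2" using x by simp
    moreover have "x\<^sup>2 \<noteq> N" using N square_mod_8_not_5 by metis
    ultimately show ?thesis using that by (metis (mono_tags) mem_Collect_eq order_le_less)
  qed
  have oddx: "odd x" if "x\<^sup>2 + 4 * y * z = N" for x y z
  proof
    assume "even x"
    then have "even (x\<^sup>2 + 4 * y * z)" by simp
    then have "even N" using that by simp
    then show False using N by presburger
  qed
  have "(\<Sum>x\<in>?X. (N - 5 * x\<^sup>2) * divisor_sum ((N - x\<^sup>2) div 4))
      = (\<Sum>x\<in>?X. \<Sum>z\<in>?Z x. (N - 5 * x\<^sup>2) * z)"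
    by (simp add: divisor_sum_def sum_distrib_left)
  also have "\<dots> = (\<Sum>(x, z)\<in>(SIGMA x:?X. ?Z x). (N - 5 * x\<^sup>2) * z)"
  proof (rule sum.Sigma)
    show "\<forall>x\<in>?X. finite (?Z x)"
    proof
      fix x assume "x \<in> ?X"
      from four[OF this] have "(N - x\<^sup>2) div 4 \<noteq> 0" by fastforce
      then show "finite (?Z x)" by (rule finite_positive_divisors)
    qed
  qed simp
  also have "\<dots> = (\<Sum>(x, y, z)\<in>disc_triples N. -4 * (z * (x\<^sup>2 - y * z)))"
  proof (rule sum.reindex_bij_witness[of _ "\<lambda>(x, y, z). (x, z)" "\<lambda>(x, z). (x, (N - x\<^sup>2) div 4 div z, z)"])
    fix t assume t: "t \<in> (SIGMA x:?X. ?Z x)"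
    then obtain x z where [simp]: "t = (x, z)" and *: "odd x" "x\<^sup>2 \<le> N" "0 < z" "z dvd (N - x\<^sup>2) div 4"
      by auto
    then have "4 dvd N - x\<^sup>2" "x\<^sup>2 < N" using four[of x] by auto
    then obtain m where m: "N - x\<^sup>2 = 4 * m" "m > 0" by (auto elim!: dvdE)
    with * obtain y where y: "m = z * y" by (auto elim!: dvdE)
    with m * have "y > 0" by (simp add: zero_less_mult_iff)
    have quot: "(N - x\<^sup>2) div 4 div z = y" using m y * by simp
    have N_eq: "N = x\<^sup>2 + 4 * (z * y)" using m y by simp
    show "(case t of (x, z) \<Rightarrow> (x, (N - x\<^sup>2) div 4 div z, z)) \<in> disc_triples N"
      using quot N_eq * \<open>y > 0\<close> by (simp add: disc_triples_def ac_simps)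
    show "(case (case t of (x, z) \<Rightarrow> (x, (N - x\<^sup>2) div 4 div z, z)) of (x, y, z) \<Rightarrow> (x, z)) = t"
      by simp
    have "-4 * (z * (x\<^sup>2 - y * z)) = (N - 5 * x\<^sup>2) * z" unfolding N_eq by (simp add: algebra_simps)
    then show "(case (case t of (x, z) \<Rightarrow> (x, (N - x\<^sup>2) div 4 div z, z)) of (x, y, z) \<Rightarrow> -4 * (z * (x\<^sup>2 - y * z)))
        = (case t of (x, z) \<Rightarrow> (N - 5 * x\<^sup>2) * z)"
      using quot by simp
  next
    fix t assume "t \<in> disc_triples N"
    then obtain x y z where [simp]: "t = (x, y, z)" and *: "x\<^sup>2 + 4 * y * z = N" "0 < y" "0 < z"
      by (auto simp: disc_triples_def)
    have m: "(N - x\<^sup>2) div 4 = y * z" using * by (auto simp: mult.assoc)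
    show "(case (case t of (x, y, z) \<Rightarrow> (x, z)) of (x, z) \<Rightarrow> (x, (N - x\<^sup>2) div 4 div z, z)) = t"
      using m * by simp
    have "0 < y * z" using * by simp
    then have "x\<^sup>2 \<le> N" using * unfolding mult.assoc by linarith
    then show "(case t of (x, y, z) \<Rightarrow> (x, z)) \<in> (SIGMA x:?X. ?Z x)"
      using m * oddx by simp
  qed
  also have "\<dots> = -4 * (\<Sum>(x, y, z)\<in>disc_triples N. z * (x\<^sup>2 - y * z))"
    unfolding sum_distrib_left by (rule sum.cong) auto
  finally show ?thesis using disc_triples_cubic_sum[OF N] by simp
qed

section \<open>Sums of four odd squares\<close>

lemma sq_reps_0: "sq_reps A 0 n = (if n = 0 then {[]} else {})"
  by (auto simp: sq_reps_def)

lemma square_mod_4: "x\<^sup>2 mod 4 = x mod 2" for x :: int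
proof -
  have "x mod 4 \<in> {0..<4}" by simp
  then have "x mod 4 \<in> {0,1,2,3}" by auto
  then have "(x mod 4)\<^sup>2 mod 4 = (x mod 4) mod 2" by auto
  then show ?thesis by (simp add: power_mod mod_mod_cancel)
qed

lemma odd_square_mod_8: "odd x \<Longrightarrow> x\<^sup>2 mod 8 = 1" for x :: int
proof -
  assume "odd x"
  have "x mod 8 \<in> {0..<8}" by simp
  then have "x mod 8 \<in> {0,1,2,3,4,5,6,7}" by auto
  moreover have "odd (x mod 8)" using \<open>odd x\<close> by presburger
  ultimately have "(x mod 8)\<^sup>2 mod 8 = 1" by auto
  then show ?thesis by (simp add: power_mod)
qed

lemma small_odd_squares:
  assumes "1 \<le> n" "n < 9"
  shows "{x::int. odd x \<and> x\<^sup>2 \<le> n} = {-1, 1}"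
proof -
  have "x = 1 \<or> x = -1" if "odd x" "x\<^sup>2 \<le> n" for x :: int
  proof -
    have "\<bar>x\<bar> < 3" using that assms power2_less_imp_less[of "\<bar>x\<bar>" 3] by simp
    then show ?thesis using \<open>odd x\<close> by presburger
  qed
  then show ?thesis using assms by auto
qed

lemma divisor_sum_1 [simp]: "divisor_sum 1 = 1"
proof -
  have "{d::int. 0 < d \<and> d dvd 1} = {1}" by auto
  then show ?thesis by (simp add: divisor_sum_def)
qed

text \<open>Both sides satisfy the same recursion, taken at $N = 4m + 1$: there the terms $x = \pm 1$
  involve the value at \<open>m\<close>, with the coefficient $N - 5$, which vanishes only for $m = 1$, and all
  other terms involve smaller odd numbers. The case $m = 1$ is $1 + 1 + 1 + 1 = 4$ with its 16
  choices of signs.\<close>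

theorem card_four_odd_squares:
  assumes "odd m" "m > 0"
  shows "int (card (sq_reps {x. odd x} 4 (4 * m))) = 16 * divisor_sum m"
  using assms
proof (induction "nat m" arbitrary: m rule: less_induct)
  case less
  let ?O = "\<lambda>n. int (card (sq_reps {x. odd x} 4 n))"
  show ?case
  proof (cases "m = 1")
    case True
    have "card (sq_reps {x. odd x} (Suc (Suc (Suc (Suc 0)))) 4) = 16"
      unfolding card_sq_reps_Suc mem_Collect_eq by (simp add: small_odd_squares sq_reps_0)
    then show ?thesis using True by (simp add: eval_nat_numeral)
  next
    case False
    then have "m > 1" using less.prems by simp
    define N where "N = 4 * m + 1"
    have N: "N mod 8 = 5" using \<open>odd m\<close> unfolding N_def by presburger
    let ?X = "{x::int. odd x \<and> x\<^sup>2 \<le> N}"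
    let ?t = "\<lambda>x. (N - 5 * x\<^sup>2) * (?O (N - x\<^sup>2) - 16 * divisor_sum ((N - x\<^sup>2) div 4))"
    have "(\<Sum>x\<in>?X. (N - 5 * x\<^sup>2) * ?O (N - x\<^sup>2)) = 0"
      using sq_reps_recursion[where A = "{x. odd x}" and n = N and k = 4] by simp
    moreover have "(\<Sum>x\<in>?X. 16 * ((N - 5 * x\<^sup>2) * divisor_sum ((N - x\<^sup>2) div 4))) = 0"
      using divisor_sum_recursion[OF N] by (simp only: sum_distrib_left[symmetric])
    ultimately have "0 = (\<Sum>x\<in>?X. (N - 5 * x\<^sup>2) * ?O (N - x\<^sup>2)) - 
        (\<Sum>x\<in>?X. 16 * ((N - 5 * x\<^sup>2) * divisor_sum ((N - x\<^sup>2) div 4)))" by simp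
    also have "\<dots> = sum ?t ?X"
      unfolding sum_subtractf[symmetric] by (rule sum.cong) (auto simp: algebra_simps)
    also have "\<dots> = sum ?t {-1, 1}"
    proof (rule sum.mono_neutral_right)
      show "{-1, 1} \<subseteq> ?X" using \<open>m > 1\<close> by (auto simp: N_def)
      show "\<forall>x\<in>?X - {-1, 1}. ?t x = 0"
      proof
        fix x assume x: "x \<in> ?X - {-1, 1}"
        then have "odd x" "x\<^sup>2 \<le> N" by auto
        have "\<bar>x\<bar> > 1" using x \<open>odd x\<close> by (auto simp: abs_if split: if_splits) presburger+
        then have "x\<^sup>2 > 1" by (metis abs_square_le_1 linorder_not_less)
        define m' where "m' = (N - x\<^sup>2) div 4"
        have "(N - x\<^sup>2) mod 8 = 4"
          using N odd_square_mod_8[OF \<open>odd x\<close>] by presburger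
        moreover have "k = 4 * (k div 4) \<and> odd (k div 4)" if "k mod 8 = 4" for k :: int
          using that by presburger
        ultimately have m': "N - x\<^sup>2 = 4 * m'" "odd m'" unfolding m'_def by blast+
        then have "m' > 0" "m' < m"
          using \<open>x\<^sup>2 > 1\<close> \<open>x\<^sup>2 \<le> N\<close> \<open>(N - x\<^sup>2) mod 8 = 4\<close> unfolding N_def
          by (auto simp: order_le_less)
        then have "?O (4 * m') = 16 * divisor_sum m'" using m' by (intro less.hyps) auto
        then show "?t x = 0" using m' by simp
      qed
    qed simp
    also have "\<dots> = 2 * (4 * m - 4) * (?O (4 * m) - 16 * divisor_sum m)"
      by (simp add: N_def)
    finally show ?thesis using \<open>m > 1\<close> by simp
  qed
qed

section \<open>Jacobi's four-square theorem\<close>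

definition four_squares :: "int \<Rightarrow> (int \<times> int \<times> int \<times> int) set" where
  "four_squares n = {(a, b, c, d). a\<^sup>2 + b\<^sup>2 + c\<^sup>2 + d\<^sup>2 = n}"

lemma bij_betw_sq_reps_4:
  "bij_betw (\<lambda>(a, b, c, d). [a, b, c, d])
    {(a, b, c, d) \<in> four_squares n. {a, b, c, d} \<subseteq> A} (sq_reps A 4 n)"
proof (rule bij_betw_imageI)
  show "(\<lambda>(a, b, c, d). [a, b, c, d]) ` {(a, b, c, d) \<in> four_squares n. {a, b, c, d} \<subseteq> A} = sq_reps A 4 n"
  proof (intro equalityI subsetI)
    fix xs assume "xs \<in> sq_reps A 4 n"
    moreover from this obtain a b c d where "xs = [a, b, c, d]"
      by (auto simp: sq_reps_def eval_nat_numeral length_Suc_conv)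
    ultimately show "xs \<in> (\<lambda>(a, b, c, d). [a, b, c, d]) ` {(a, b, c, d) \<in> four_squares n. {a, b, c, d} \<subseteq> A}"
      by (force simp: sq_reps_def four_squares_def add.assoc)
  qed (auto simp: sq_reps_def four_squares_def)
qed (auto simp: inj_on_def)

lemma finite_four_squares [simp]: "finite (four_squares n)"
  using bij_betw_finite[OF bij_betw_sq_reps_4[of n UNIV]] by simp

lemma card_sq_reps_4: "card (sq_reps UNIV 4 n) = card (four_squares n)"
  using bij_betw_same_card[OF bij_betw_sq_reps_4[of n UNIV]] by simp

text \<open>The map $(a,b) \mapsto (a+b,\,a-b)$ doubles $a^2 + b^2$ and reaches exactly the pairs of equal parity.\<close>

lemma card_paired_four_squares:
  "card {(a, b, c, d) \<in> four_squares (2 * n). even (a + b) \<and> even (c + d)} = card (four_squares n)"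
proof (rule bij_betw_same_card)
  show "bij_betw (\<lambda>(a, b, c, d). ((a + b) div 2, (a - b) div 2, (c + d) div 2, (c - d) div 2))
    {(a, b, c, d) \<in> four_squares (2 * n). even (a + b) \<and> even (c + d)} (four_squares n)"
  proof (rule bij_betw_byWitness[where f' = "\<lambda>(a, b, c, d). (a + b, a - b, c + d, c - d)"])
    show "(\<lambda>(a, b, c, d). ((a + b) div 2, (a - b) div 2, (c + d) div 2, (c - d) div 2)) `
        {(a, b, c, d) \<in> four_squares (2 * n). even (a + b) \<and> even (c + d)} \<subseteq> four_squares n"
    proof clarsimp
      fix a b c d :: int assume *: "(a, b, c, d) \<in> four_squares (2 * n)" "even a = even b" "even c = even d"
      then have "2 dvd a - b" "2 dvd c - d" by auto
      then obtain e f where "a - b = 2 * e" "c - d = 2 * f" unfolding dvd_def by blast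
      then have "a = b + 2 * e" "c = d + 2 * f" by auto
      then show "((a + b) div 2, (a - b) div 2, (c + d) div 2, (c - d) div 2) \<in> four_squares n"
        using * by (simp add: four_squares_def power2_eq_square algebra_simps)
    qed
  qed (auto simp: four_squares_def power2_eq_square algebra_simps; presburger)+
qed

lemma four_squares_mod_4:
  "(a, b, c, d) \<in> four_squares n \<Longrightarrow> (a mod 2 + b mod 2 + c mod 2 + d mod 2) mod 4 = n mod 4"
proof -
  have "(p mod 4 + q mod 4 + r mod 4 + s mod 4) mod 4 = (p + q + r + s) mod 4" for p q r s :: int
    by (intro mod_add_cong mod_mod_trivial)
  then show "(a, b, c, d) \<in> four_squares n \<Longrightarrow> ?thesis"
    unfolding four_squares_def square_mod_4[symmetric] by auto
qed

text \<open>The residue modulo 4 of a sum of four squares counts its odd terms, so these two lemmas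
  sort the representations of $2n$ by parity pattern.\<close>

lemma four_parities_0:
  fixes a b c d :: int
  assumes "(a mod 2 + b mod 2 + c mod 2 + d mod 2) mod 4 = 0"
  shows "odd a \<and> odd b \<and> odd c \<and> odd d \<or> even a \<and> even b \<and> even c \<and> even d"
  using assms
  by (cases "odd a"; cases "odd b"; cases "odd c"; cases "odd d"; simp add: mod_2_eq_odd)

lemma four_parities_2:
  fixes a b c d :: int
  assumes "(a mod 2 + b mod 2 + c mod 2 + d mod 2) mod 4 = 2"
  shows "(even (a + b) \<and> even (c + d) \<and> odd (a + c) \<and> odd (a + d)) \<or>
      (odd (a + b) \<and> even (a + c) \<and> even (b + d) \<and> odd (a + d)) \<or>
      (odd (a + b) \<and> odd (a + c) \<and> even (a + d) \<and> even (b + c))"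
  using assms
  by (cases "odd a"; cases "odd b"; cases "odd c"; cases "odd d"; simp add: mod_2_eq_odd)

lemma card_four_squares_double_even:
  assumes "even n"
  shows "card (four_squares (2 * n)) = card (four_squares n)"
proof -
  have "even (a + b) \<and> even (c + d)" if "(a, b, c, d) \<in> four_squares (2 * n)" for a b c d
  proof -
    have "2 * n mod 4 = 0" using assms by presburger
    then have "(a mod 2 + b mod 2 + c mod 2 + d mod 2) mod 4 = 0"
      using four_squares_mod_4[OF that] by simp
    then show ?thesis using four_parities_0[of a b c d] by auto
  qed
  then have "{(a, b, c, d) \<in> four_squares (2 * n). even (a + b) \<and> even (c + d)} = four_squares (2 * n)"
    by auto
  then show ?thesis using card_paired_four_squares[of n] by simp
qed

text \<open>A representation of twice an odd number has two odd and two even terms. Pairing terms of equal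
  parity is one of three pairings of the four positions, and permuting positions shows that
  each pairing accounts for the same number of representations.\<close>

lemma card_four_squares_double_odd:
  assumes "odd n"
  shows "card (four_squares (2 * n)) = 3 * card (four_squares n)"
proof -
  let ?F = "four_squares (2 * n)"
  let ?A = "{(a, b, c, d) \<in> ?F. even (a + b) \<and> even (c + d)}"
  let ?B = "{(a, b, c, d) \<in> ?F. even (a + c) \<and> even (b + d)}"
  let ?C = "{(a, b, c, d) \<in> ?F. even (a + d) \<and> even (b + c)}"
  have fin: "finite ?A" "finite ?B" "finite ?C"
    by (rule finite_subset[OF _ finite_four_squares[of "2 * n"]]; force)+
  have bij_B: "bij_betw (\<lambda>(a, b, c, d). (a, c, b, d)) ?B ?A"
    by (rule bij_betw_byWitness[where f' = "\<lambda>(a, b, c, d). (a, c, b, d)"])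
      (auto simp: four_squares_def algebra_simps)
  have bij_C: "bij_betw (\<lambda>(a, b, c, d). (a, d, c, b)) ?C ?A"
    by (rule bij_betw_byWitness[where f' = "\<lambda>(a, b, c, d). (a, d, c, b)"])
      (auto simp: four_squares_def algebra_simps)
  note cards = bij_betw_same_card[OF bij_B] bij_betw_same_card[OF bij_C]
  have parity: "(even (a + b) \<and> even (c + d) \<and> odd (a + c) \<and> odd (a + d)) \<or>
      (odd (a + b) \<and> even (a + c) \<and> even (b + d) \<and> odd (a + d)) \<or>
      (odd (a + b) \<and> odd (a + c) \<and> even (a + d) \<and> even (b + c))"
    if "(a, b, c, d) \<in> ?F" for a b c d
  proof -
    have "2 * n mod 4 = 2" using assms by presburger
    then have "(a mod 2 + b mod 2 + c mod 2 + d mod 2) mod 4 = 2"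
      using four_squares_mod_4[OF that] by simp
    then show ?thesis by (rule four_parities_2)
  qed
  have cover: "?F = ?A \<union> ?B \<union> ?C" using parity by blast
  have disj: "?A \<inter> ?B = {}" "(?A \<union> ?B) \<inter> ?C = {}" using parity by blast+
  have "card ?F = card (?A \<union> ?B \<union> ?C)" by (rule arg_cong[OF cover])
  also have "\<dots> = card (?A \<union> ?B) + card ?C" by (intro card_Un_disjoint finite_UnI fin disj)
  also have "card (?A \<union> ?B) = card ?A + card ?B" by (intro card_Un_disjoint fin disj)
  finally have "card ?F = card ?A + card ?B + card ?C" .
  then show ?thesis using cards card_paired_four_squares[of n] by simp
qed

text \<open>The terms of a representation of $4m$ are all even or all odd.\<close>

lemma card_four_squares_times_4:
  "card (four_squares (4 * m)) = card (four_squares m) + card (sq_reps {x. odd x} 4 (4 * m))"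
proof -
  let ?F = "four_squares (4 * m)"
  let ?E = "(\<lambda>(a, b, c, d). (2 * a, 2 * b, 2 * c, 2 * d)) ` four_squares m"
  let ?O = "{(a, b, c, d) \<in> ?F. {a, b, c, d} \<subseteq> {x. odd x}}"
  have "?F \<subseteq> ?E \<union> ?O"
  proof
    fix t assume t: "t \<in> ?F"
    obtain a b c d where [simp]: "t = (a, b, c, d)" by (cases t)
    have "(a mod 2 + b mod 2 + c mod 2 + d mod 2) mod 4 = 0"
      using t four_squares_mod_4[of a b c d] by simp
    then have "odd a \<and> odd b \<and> odd c \<and> odd d \<or> even a \<and> even b \<and> even c \<and> even d"
      by (rule four_parities_0)
    then consider "odd a" "odd b" "odd c" "odd d" | "even a" "even b" "even c" "even d"
      by blast
    then show "t \<in> ?E \<union> ?O"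
    proof cases
      case 2
      then obtain a' b' c' d' where "a = 2 * a'" "b = 2 * b'" "c = 2 * c'" "d = 2 * d'"
        by (auto elim!: evenE)
      moreover from this t have "(a', b', c', d') \<in> four_squares m" by (simp add: four_squares_def)
      ultimately have "t \<in> ?E" by (intro image_eqI[of _ _ "(a', b', c', d')"]) auto
      then show ?thesis ..
    qed (use t in auto)
  qed
  moreover have "?E \<subseteq> ?F" by (auto simp: four_squares_def)
  ultimately have cover: "?F = ?E \<union> ?O" by blast
  have disj: "?E \<inter> ?O = {}" by auto
  have fin: "finite ?E" "finite ?O"
    by (simp, rule finite_subset[OF _ finite_four_squares[of "4 * m"]], blast)
  have "card ?F = card (?E \<union> ?O)" by (rule arg_cong[OF cover])
  also have "\<dots> = card ?E + card ?O" by (rule card_Un_disjoint[OF fin disj])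
  finally have "card ?F = card ?E + card ?O" .
  moreover have "card ?E = card (four_squares m)" by (rule card_image) (auto simp: inj_on_def)
  moreover have "card ?O = card (sq_reps {x. odd x} 4 (4 * m))"
    by (rule bij_betw_same_card[OF bij_betw_sq_reps_4])
  ultimately show ?thesis by simp
qed

text \<open>With $r$ for the number of representations by four squares, the parity lemmas give
  $3\,r(m) = r(2m) = r(4m) = r(m) + 16\,\sigma(m)$.\<close>

theorem Jacobi_four_squares_odd:
  assumes "odd m" "m > 0"
  shows "int (card (four_squares m)) = 8 * divisor_sum m"
proof -
  have "card (four_squares (4 * m)) = card (four_squares (2 * m))"
    using card_four_squares_double_even[of "2 * m"] by simp
  then show ?thesis
    using card_four_squares_double_odd[OF assms(1)] card_four_squares_times_4[of m]
      card_four_odd_squares[OF assms] by simp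
qed

lemma divisor_sum_mono_dvd: "a dvd b \<Longrightarrow> b \<noteq> 0 \<Longrightarrow> divisor_sum a \<le> divisor_sum b"
  unfolding divisor_sum_def
  by (rule sum_mono2) (auto intro: finite_positive_divisors dvd_trans)

text \<open>Doubling an even number leaves the number of representations unchanged and doubling an odd one
  triples it, so powers of two cost at most the factor $3$ over \<open>Jacobi_four_squares_odd\<close>.\<close>

theorem card_four_squares_le:
  assumes "n > 0"
  shows "int (card (four_squares n)) \<le> 24 * divisor_sum n"
  using assms
proof (induction "nat n" arbitrary: n rule: less_induct)
  case less
  show ?case
  proof (cases "even n")
    case False
    then have "int (card (four_squares n)) = 8 * divisor_sum n"
      using Jacobi_four_squares_odd less.prems by simp
    moreover have "divisor_sum n \<ge> 0" by (auto simp: divisor_sum_def intro: sum_nonneg)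
    ultimately show ?thesis by simp
  next
    case True
    then obtain k where n: "n = 2 * k" by blast
    have mono: "divisor_sum k \<le> divisor_sum n" using n less.prems by (intro divisor_sum_mono_dvd) auto
    show ?thesis
    proof (cases "even k")
      case True
      then have "int (card (four_squares n)) \<le> 24 * divisor_sum k"
        using less.hyps[of k] less.prems n card_four_squares_double_even[of k] by simp
      then show ?thesis using mono by simp
    next
      case False
      then have "int (card (four_squares n)) = 24 * divisor_sum k"
        using less.prems n Jacobi_four_squares_odd[of k] card_four_squares_double_odd[of k] by simp
      then show ?thesis using mono by simp
    qed
  qed
qed

section \<open>Divisor sums along $n - x^2$\<close>

lemma le_divisor_sum: "n > 0 \<Longrightarrow> n \<le> divisor_sum n"
  unfolding divisor_sum_def
  by (rule member_le_sum) (auto intro: finite_positive_divisors)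

text \<open>Here \<open>X\<close> is the integer part of $\sqrt{l}$. The divisors up to \<open>X\<close> add up to at most $X^2$, and a
  divisor beyond \<open>X\<close> is $n/e$ for a divisor \<open>e\<close> up to \<open>X\<close>. Truncating the divisors at the
  square root is what keeps the rounding errors of the later counts under control.\<close>

lemma divisor_sum_le_small_divisors:
  fixes n l X :: int
  assumes "0 < n" "n \<le> l" "0 < X" "X\<^sup>2 \<le> l" "l < (X + 1)\<^sup>2"
  shows "real_of_int (divisor_sum n) \<le> l + (\<Sum>e | e \<in> {1..X} \<and> e dvd n. l / e)"
proof -
  let ?D = "{d. 0 < d \<and> d dvd n}"
  let ?S = "{d \<in> ?D. d \<le> X}" and ?L = "{d \<in> ?D. X < d}"
  have fin: "finite ?D" using assms by (intro finite_positive_divisors) auto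
  have "sum real_of_int ?D = sum real_of_int (?S \<union> ?L)" by (rule sum.cong) auto
  also have "\<dots> = sum real_of_int ?S + sum real_of_int ?L"
    by (rule sum.union_disjoint) (auto intro: finite_subset[OF _ fin])
  also have "sum real_of_int ?S \<le> l"
  proof -
    have "sum real_of_int ?S \<le> (\<Sum>d\<in>{1..X}. real_of_int X)"
      by (rule sum_le_included[where i = id]) (auto intro: finite_subset[OF _ fin])
    also have "\<dots> = real_of_int (X\<^sup>2)" using assms by (simp add: power2_eq_square)
    finally show ?thesis using assms by linarith
  qed
  also have "sum real_of_int ?L \<le> (\<Sum>e | e \<in> {1..X} \<and> e dvd n. l / e)"
  proof (rule sum_le_included[where i = "\<lambda>e. n div e"])
    show "\<forall>d\<in>?L. \<exists>e\<in>{e. e \<in> {1..X} \<and> e dvd n}. n div e = d \<and> real_of_int d \<le> l / e"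
    proof
      fix d assume d: "d \<in> ?L"
      then obtain e where e: "n = d * e" by (auto elim: dvdE)
      with d assms have "e > 0" by (simp add: zero_less_mult_iff)
      have "e \<le> X"
      proof (rule ccontr)
        assume "\<not> e \<le> X"
        then have "(X + 1) * (X + 1) \<le> d * e" using d assms by (intro mult_mono) auto
        then show False using e assms by (simp add: power2_eq_square)
      qed
      moreover have "real_of_int d \<le> l / e"
        using assms e \<open>e > 0\<close> by (simp add: field_simps flip: of_int_mult)
      ultimately show "\<exists>e\<in>{e. e \<in> {1..X} \<and> e dvd n}. n div e = d \<and> real_of_int d \<le> l / e"
        using \<open>e > 0\<close> e by (intro bexI[of _ e]) auto
    qed
  qed (use assms in \<open>auto intro: finite_subset[OF _ fin]\<close>)
  finally show ?thesis by (simp add: divisor_sum_def)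
qed

lemma card_residue_class_le:
  fixes X L :: int
  assumes "0 < L" "0 \<le> X" "B \<subseteq> {-X..X}" "\<And>x y. x \<in> B \<Longrightarrow> y \<in> B \<Longrightarrow> L dvd x - y"
  shows "int (card B) \<le> 2 * X div L + 1"
proof -
  have "inj_on (\<lambda>x. (x + X) div L) B"
  proof
    fix x y assume xy: "x \<in> B" "y \<in> B" "(x + X) div L = (y + X) div L"
    have "L dvd (x + X) - (y + X)" using assms(4)[of x y] xy by simp
    then have "(x + X) mod L = (y + X) mod L" by (simp add: mod_eq_dvd_iff)
    with xy show "x = y" by (metis add_right_cancel mult_div_mod_eq)
  qed
  moreover have "(\<lambda>x. (x + X) div L) ` B \<subseteq> {0..2 * X div L}"
    using assms by (force intro: zdiv_mono1 simp: pos_imp_zdiv_nonneg_iff)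
  ultimately have "card B \<le> card {0..2 * X div L}"
    by (metis card_image card_mono finite_atLeastAtMost_int)
  moreover have "2 * X div L \<ge> 0" using assms by (simp add: pos_imp_zdiv_nonneg_iff)
  ultimately show ?thesis by simp
qed

text \<open>If \<open>r\<close> is one solution of $x^2 \equiv l$ modulo \<open>e\<close>, every solution satisfies
  $e \mid (x-r)(x+r)$, so there is a factorisation $e = gh$ with $g \mid x-r$ and $h \mid x+r$. For given
  \<open>g\<close> and \<open>h\<close> the solutions lie in one residue class modulo the least common multiple of
  \<open>g\<close> and \<open>h\<close>. Since $e \le X$, the rounding error $1$ in the count is absorbed by the main term.\<close>

lemma card_square_roots_mod_le:
  fixes l e X :: int
  assumes "0 < e" "e \<le> X"
  shows "real (card {x\<in>{-X..X}. e dvd l - x\<^sup>2})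
    \<le> (\<Sum>(g, h) | (g, h) \<in> {1..X} \<times> {1..X} \<and> g * h = e. 3 * real_of_int X * real_of_int (gcd g h) / real_of_int (g * h))"
proof (cases "{x\<in>{-X..X}. e dvd l - x\<^sup>2} = {}")
  case True
  have "0 \<le> (\<Sum>(g, h) | (g, h) \<in> {1..X} \<times> {1..X} \<and> g * h = e. 3 * real_of_int X * real_of_int (gcd g h) / real_of_int (g * h))"
    by (rule sum_nonneg) auto
  then show ?thesis unfolding True by simp
next
  case False
  then obtain r where r: "e dvd l - r\<^sup>2" by auto
  let ?P = "{(g, h). (g, h) \<in> {1..X} \<times> {1..X} \<and> g * h = e}"
  let ?B = "\<lambda>(g, h). {x\<in>{-X..X}. g dvd x - r \<and> h dvd x + r}"
  have finP: "finite ?P" by (rule finite_subset[of _ "{1..X} \<times> {1..X}"]) auto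
  have finB: "finite (?B p)" for p by (rule finite_subset[of _ "{-X..X}"]) (auto split: prod.splits)
  have "{x\<in>{-X..X}. e dvd l - x\<^sup>2} \<subseteq> (\<Union>p\<in>?P. ?B p)"
  proof
    fix x assume x: "x \<in> {x\<in>{-X..X}. e dvd l - x\<^sup>2}"
    then have "e dvd (l - r\<^sup>2) - (l - x\<^sup>2)" using r by (blast intro: dvd_diff)
    then have "e dvd (x - r) * (x + r)" by (simp add: power2_eq_square algebra_simps)
    then obtain g h where gh: "e = g * h" "g dvd x - r" "h dvd x + r"
      using division_decomp by blast
    have prod: "\<bar>g\<bar> * \<bar>h\<bar> = e" using gh assms by (simp flip: abs_mult)
    then have "g \<noteq> 0" "h \<noteq> 0" using assms by auto
    then have "\<bar>g\<bar> * 1 \<le> \<bar>g\<bar> * \<bar>h\<bar>" "1 * \<bar>h\<bar> \<le> \<bar>g\<bar> * \<bar>h\<bar>" by (intro mult_mono; auto)+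
    then have "(\<bar>g\<bar>, \<bar>h\<bar>) \<in> ?P" using prod assms \<open>g \<noteq> 0\<close> \<open>h \<noteq> 0\<close> by auto
    moreover have "x \<in> ?B (\<bar>g\<bar>, \<bar>h\<bar>)" using gh x by simp
    ultimately show "x \<in> (\<Union>p\<in>?P. ?B p)" by blast
  qed
  then have "card {x\<in>{-X..X}. e dvd l - x\<^sup>2} \<le> card (\<Union>p\<in>?P. ?B p)"
    by (rule card_mono[rotated]) (intro finite_UN_I finP finB)
  also have "\<dots> \<le> (\<Sum>p\<in>?P. card (?B p))" by (rule card_UN_le[OF finP])
  finally have "real (card {x\<in>{-X..X}. e dvd l - x\<^sup>2}) \<le> real (\<Sum>p\<in>?P. card (?B p))"
    by (simp only: of_nat_le_iff)
  then have "real (card {x\<in>{-X..X}. e dvd l - x\<^sup>2}) \<le> (\<Sum>p\<in>?P. real (card (?B p)))"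
    by (simp only: of_nat_sum)
  also have "\<dots> \<le> (\<Sum>(g, h)\<in>?P. 3 * real_of_int X * real_of_int (gcd g h) / real_of_int (g * h))"
  proof (rule sum_mono)
    fix p assume "p \<in> ?P"
    moreover obtain g h where p: "p = (g, h)" by (cases p)
    ultimately have gh: "g > 0" "h > 0" "g * h \<le> X" using assms by auto
    have "int (card (?B (g, h))) \<le> 2 * X div lcm g h + 1"
    proof (rule card_residue_class_le)
      fix x y assume "x \<in> ?B (g, h)" "y \<in> ?B (g, h)"
      then have "g dvd x - r" "g dvd y - r" "h dvd x + r" "h dvd y + r" by auto
      then have "g dvd (x - r) - (y - r)" "h dvd (x + r) - (y + r)" by (blast intro: dvd_diff)+
      then show "lcm g h dvd x - y" by (intro lcm_least) simp_all
    qed (use gh assms in \<open>auto simp: lcm_pos_int\<close>)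
    then have "real (card (?B (g, h))) \<le> real_of_int (2 * X div lcm g h) + 1" by linarith
    also have "real_of_int (2 * X div lcm g h) \<le> 2 * X / lcm g h"
      using real_of_int_div4[of "2 * X" "lcm g h"] by simp
    also have "2 * X / real_of_int (lcm g h) = 2 * X * gcd g h / (g * h)"
    proof -
      have "real_of_int (lcm g h) * gcd g h = g * h"
        using prod_gcd_lcm_int[of g h] gh by (simp add: mult.commute flip: of_int_mult)
      moreover have "gcd g h > 0" using gh by simp
      ultimately show ?thesis using gh by (simp add: field_simps lcm_pos_int)
    qed
    also have "1 \<le> X * gcd g h / (g * h)"
    proof -
      have "gcd g h \<ge> 1" using gh by (simp add: int_one_le_iff_zero_less)
      then have "g * h * 1 \<le> X * gcd g h" using gh assms by (intro mult_mono) auto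
      then have "real_of_int (g * h) \<le> real_of_int (X * gcd g h)" by (simp only: of_int_le_iff mult_1_right)
      then show ?thesis using gh by (simp add: field_simps)
    qed
    finally show "real (card (?B p)) \<le> (case p of (g, h) \<Rightarrow> 3 * real_of_int X * real_of_int (gcd g h) / real_of_int (g * h))"
      by (simp add: p field_simps)
  qed
  finally show ?thesis .
qed

definition zeta_three_halves :: real where
  "zeta_three_halves = (\<Sum>n. real (Suc n) powr (-3/2))"

lemma sum_powr_le_zeta:
  "(\<Sum>g\<in>{1..X::int}. real_of_int g powr (-3/2)) \<le> zeta_three_halves"
proof -
  have "summable (\<lambda>n. real n powr (-3/2))" by (simp add: summable_real_powr_iff)
  then have summ: "summable (\<lambda>n. real (Suc n) powr (-3/2))" by (subst summable_Suc_iff)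
  have "(\<Sum>g\<in>{1..X}. real_of_int g powr (-3/2)) = (\<Sum>n<nat X. real (Suc n) powr (-3/2))"
    by (rule sum.reindex_bij_witness[of _ "\<lambda>n. int (Suc n)" "\<lambda>g. nat (g - 1)"]) auto
  also have "\<dots> \<le> zeta_three_halves"
    unfolding zeta_three_halves_def by (rule sum_le_suminf[OF summ]) auto
  finally show ?thesis .
qed

lemma gcd_over_square_le:
  fixes g h :: int
  assumes "g > 0" "h > 0"
  shows "gcd g h / (real_of_int (g * h))\<^sup>2 \<le> real_of_int g powr (-3/2) * real_of_int h powr (-3/2)"
proof -
  define t where "t = real_of_int (g * h)"
  have "t > 0" using assms by (simp add: t_def)
  have "gcd g h \<le> g" "gcd g h \<le> h" using assms by (auto intro: zdvd_imp_le)
  then have "gcd g h * gcd g h \<le> g * h" using assms by (intro mult_mono) auto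
  then have "(real_of_int (gcd g h))\<^sup>2 \<le> t"
    unfolding t_def power2_eq_square by (simp only: of_int_mult[symmetric] of_int_le_iff)
  then have "gcd g h \<le> t powr (1/2)" using \<open>t > 0\<close> by (simp add: powr_half_sqrt real_le_rsqrt)
  then have "gcd g h / t\<^sup>2 \<le> t powr (1/2) / t powr 2"
    using \<open>t > 0\<close> by (simp add: divide_right_mono)
  also have "\<dots> = t powr (-3/2)" by (simp flip: powr_diff)
  finally show ?thesis using assms by (simp add: t_def powr_mult)
qed

text \<open>Summed over \<open>e\<close>, the previous bound ranges over independent \<open>g\<close> and \<open>h\<close>, and
  $\gcd(g,h) \le \sqrt{gh}$ makes the double series converge with a bound independent of \<open>l\<close>.\<close>

lemma sum_card_square_roots_mod_le:
  fixes l X :: int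
  assumes "0 < X"
  shows "(\<Sum>e\<in>{1..X}. real (card {x\<in>{-X..X}. e dvd l - x\<^sup>2}) / e) \<le> 3 * real_of_int X * zeta_three_halves\<^sup>2"
proof -
  let ?G = "{1..X} \<times> {1..X}"
  let ?w = "\<lambda>(g::int, h::int). real_of_int g powr (-3/2) * real_of_int h powr (-3/2)"
  have "(\<Sum>e\<in>{1..X}. real (card {x\<in>{-X..X}. e dvd l - x\<^sup>2}) / e)
      \<le> (\<Sum>e\<in>{1..X}. \<Sum>p | p \<in> ?G \<and> fst p * snd p = e. 3 * real_of_int X * ?w p)"
  proof (rule sum_mono)
    fix e assume e: "e \<in> {1..X}"
    then have "real (card {x\<in>{-X..X}. e dvd l - x\<^sup>2}) / e \<le>
        (\<Sum>(g, h) | (g, h) \<in> ?G \<and> g * h = e. 3 * real_of_int X * real_of_int (gcd g h) / real_of_int (g * h)) / e"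
      by (intro divide_right_mono card_square_roots_mod_le) auto
    also have "\<dots> = (\<Sum>p | p \<in> ?G \<and> fst p * snd p = e. 3 * real_of_int X * real_of_int (gcd (fst p) (snd p)) / real_of_int (fst p * snd p) / real_of_int e)"
      unfolding sum_divide_distrib by (rule sum.cong) auto
    also have "\<dots> \<le> (\<Sum>p | p \<in> ?G \<and> fst p * snd p = e. 3 * real_of_int X * ?w p)"
    proof (rule sum_mono)
      fix p assume p: "p \<in> {p. p \<in> ?G \<and> fst p * snd p = e}"
      obtain g h where [simp]: "p = (g, h)" by (cases p)
      have gh: "g > 0" "h > 0" "e = g * h" using p by auto
      have "3 * real_of_int X * (gcd g h / (real_of_int (g * h))\<^sup>2) \<le> 3 * real_of_int X * ?w p"
        using gcd_over_square_le[of g h] gh assms by (intro mult_left_mono) auto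
      then show "3 * real_of_int X * real_of_int (gcd (fst p) (snd p)) / real_of_int (fst p * snd p) / real_of_int e \<le> 3 * real_of_int X * ?w p"
        using gh by (simp add: power2_eq_square)
    qed
    finally show "real (card {x\<in>{-X..X}. e dvd l - x\<^sup>2}) / e
        \<le> (\<Sum>p | p \<in> ?G \<and> fst p * snd p = e. 3 * real_of_int X * ?w p)" .
  qed
  \<comment> \<open>Only pairs with product at most \<open>X\<close> occur, which allows regrouping by the product.\<close>
  also have "\<dots> = (\<Sum>e\<in>{1..X}. \<Sum>p | p \<in> {p \<in> ?G. fst p * snd p \<le> X} \<and> fst p * snd p = e. 3 * real_of_int X * ?w p)"
    by (intro sum.cong) auto
  also have "\<dots> = (\<Sum>p\<in>{p \<in> ?G. fst p * snd p \<le> X}. 3 * real_of_int X * ?w p)"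
  proof (rule sum.group)
    have "1 \<le> g * h" if "1 \<le> g" "1 \<le> h" for g h :: int
      using mult_mono[of 1 g 1 h] that by simp
    then show "(\<lambda>p. fst p * snd p) ` {p \<in> ?G. fst p * snd p \<le> X} \<subseteq> {1..X}" by auto
  qed auto
  also have "\<dots> \<le> (\<Sum>p\<in>?G. 3 * real_of_int X * ?w p)"
    by (rule sum_mono2) (use assms in auto)
  also have "\<dots> = 3 * real_of_int X * (\<Sum>g\<in>{1..X}. real_of_int g powr (-3/2))\<^sup>2"
  proof -
    have "(\<Sum>g\<in>{1..X}. real_of_int g powr (-3/2))\<^sup>2 = (\<Sum>p\<in>?G. ?w p)"
      by (simp add: power2_eq_square sum_product sum.cartesian_product)
    then show ?thesis by (simp only: sum_distrib_left)
  qed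
  also have "\<dots> \<le> 3 * real_of_int X * zeta_three_halves\<^sup>2"
    using sum_powr_le_zeta[of X] assms by (intro mult_left_mono power_mono sum_nonneg) auto
  finally show ?thesis .
qed

text \<open>On average over \<open>x\<close>, the divisor sum of $l - x^2$ is of order \<open>l\<close>, although a single value may
  be larger by an unbounded factor. Exchanging the sums over \<open>x\<close> and over the small divisors
  \<open>e\<close> reduces this to counting square roots of \<open>l\<close> modulo \<open>e\<close>.\<close>

lemma sum_divisor_sum_shifted_squares_le:
  fixes l X :: int
  assumes "0 < X" "X\<^sup>2 \<le> l" "l < (X + 1)\<^sup>2"
  shows "(\<Sum>x | x\<^sup>2 < l. real_of_int (divisor_sum (l - x\<^sup>2))) \<le> 3 * (1 + zeta_three_halves\<^sup>2) * l * X"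
proof -
  have "l > 0" using assms by (smt (verit) zero_less_power)
  have sub: "{x. x\<^sup>2 < l} \<subseteq> {-X..X}"
  proof
    fix x assume "x \<in> {x. x\<^sup>2 < l}"
    then have "\<bar>x\<bar>\<^sup>2 < (X + 1)\<^sup>2" using assms by simp
    then have "\<bar>x\<bar> < X + 1" by (rule power2_less_imp_less) (use assms in simp)
    then show "x \<in> {-X..X}" by auto
  qed
  then have fin: "finite {x. x\<^sup>2 < l}" by (rule finite_subset) simp
  have "(\<Sum>x | x\<^sup>2 < l. real_of_int (divisor_sum (l - x\<^sup>2)))
      \<le> (\<Sum>x | x\<^sup>2 < l. l + (\<Sum>e | e \<in> {1..X} \<and> e dvd (l - x\<^sup>2). l / e))"
    by (intro sum_mono divisor_sum_le_small_divisors) (use assms in auto)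
  also have "\<dots> \<le> (\<Sum>x\<in>{-X..X}. l + (\<Sum>e | e \<in> {1..X} \<and> e dvd (l - x\<^sup>2). l / e))"
    using \<open>l > 0\<close> by (intro sum_mono2 sub add_nonneg_nonneg sum_nonneg) auto
  also have "\<dots> = (2 * X + 1) * l + (\<Sum>x\<in>{-X..X}. \<Sum>e | e \<in> {1..X} \<and> e dvd (l - x\<^sup>2). l / e)"
    using assms by (simp add: sum.distrib)
  also have "(\<Sum>x\<in>{-X..X}. \<Sum>e | e \<in> {1..X} \<and> e dvd (l - x\<^sup>2). l / e)
      = (\<Sum>e\<in>{1..X}. \<Sum>x | x \<in> {-X..X} \<and> e dvd (l - x\<^sup>2). l / e)"
    by (rule sum.swap_restrict) auto
  also have "\<dots> = l * (\<Sum>e\<in>{1..X}. real (card {x\<in>{-X..X}. e dvd l - x\<^sup>2}) / e)"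
    by (simp add: sum_distrib_left mult.commute)
  also have "\<dots> \<le> l * (3 * real_of_int X * zeta_three_halves\<^sup>2)"
    using sum_card_square_roots_mod_le[OF \<open>0 < X\<close>, of l] \<open>l > 0\<close> by (intro mult_left_mono) auto
  also have "(2 * X + 1) * l + real_of_int l * (3 * real_of_int X * zeta_three_halves\<^sup>2) \<le> 3 * (1 + zeta_three_halves\<^sup>2) * l * X"
  proof -
    have "(2 * X + 1) * l \<le> (3 * X) * l" using assms \<open>l > 0\<close> by (intro mult_right_mono) auto
    then have "real_of_int ((2 * X + 1) * l) \<le> real_of_int ((3 * X) * l)" by (simp only: of_int_le_iff)
    then show ?thesis by (simp add: algebra_simps)
  qed
  finally show ?thesis by simp
qed

section \<open>Sums of five or more squares\<close>

lemma sq_reps_at_0: "sq_reps UNIV k 0 = {replicate k 0}"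
proof (intro equalityI subsetI)
  fix xs assume "xs \<in> sq_reps UNIV k 0"
  then have len: "length xs = k" and "(\<Sum>x\<leftarrow>xs. x\<^sup>2) = 0" by (auto simp: sq_reps_def)
  then have "\<forall>x\<in>set xs. x = 0" by (subst (asm) sum_list_nonneg_eq_0_iff) auto
  then show "xs \<in> {replicate k 0}" using len by (metis replicate_eqI singletonI)
qed (auto simp: sq_reps_def map_replicate_const sum_list_replicate)

lemma card_bounded_squares_le:
  assumes "n \<ge> 0"
  shows "real (card {x::int. x\<^sup>2 \<le> n}) \<le> 2 * sqrt n + 1"
proof -
  define X where "X = \<lfloor>sqrt (real_of_int n)\<rfloor>"
  have "{x. x\<^sup>2 \<le> n} \<subseteq> {-X..X}"
  proof
    fix x assume "x \<in> {x. x\<^sup>2 \<le> n}"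
    then have "real_of_int \<bar>x\<bar> \<le> sqrt n"
      by (intro real_le_rsqrt) (metis mem_Collect_eq of_int_le_iff of_int_power power2_abs)
    then have "\<bar>x\<bar> \<le> X" by (simp add: X_def le_floor_iff)
    then show "x \<in> {-X..X}" by auto
  qed
  then have "card {x. x\<^sup>2 \<le> n} \<le> card {-X..X}" by (intro card_mono) auto
  moreover have "X \<ge> 0" using assms by (simp add: X_def)
  moreover have "X \<le> sqrt n" by (simp add: X_def)
  ultimately show ?thesis by simp
qed

text \<open>The terms with $x^2 = n$ contribute one representation each; all others are bounded by
  \<open>card_four_squares_le\<close>.\<close>

theorem card_five_squares_le:
  fixes n :: int
  assumes "n > 0"
  shows "real (card (sq_reps UNIV 5 n)) \<le> (72 * (1 + zeta_three_halves\<^sup>2) + 3) * n powr (3/2)"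
proof -
  define X where "X = \<lfloor>sqrt (real_of_int n)\<rfloor>"
  have X: "X \<le> sqrt n" "sqrt n < X + 1" by (simp_all add: X_def)
  have "1 \<le> sqrt n" using assms by simp
  then have "X > 0" using X by linarith
  have "real_of_int X ^ 2 \<le> sqrt n ^ 2" using X(1) \<open>X > 0\<close> by (intro power_mono) auto
  then have "real_of_int (X\<^sup>2) \<le> real_of_int n" using assms by simp
  then have Xn: "X\<^sup>2 \<le> n" by (simp only: of_int_le_iff)
  have "sqrt n ^ 2 < (real_of_int X + 1) ^ 2" using X(2) by (intro power_strict_mono) (use assms in auto)
  then have "real_of_int n < real_of_int ((X + 1)\<^sup>2)" using assms by simp
  then have nX: "n < (X + 1)\<^sup>2" by (simp only: of_int_less_iff)
  have "card (sq_reps UNIV 5 n) = (\<Sum>x | x\<^sup>2 \<le> n. card (sq_reps UNIV 4 (n - x\<^sup>2)))"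
    using card_sq_reps_Suc[of UNIV 4 n] by simp
  then have "real (card (sq_reps UNIV 5 n)) = (\<Sum>x | x\<^sup>2 \<le> n. real (card (sq_reps UNIV 4 (n - x\<^sup>2))))"
    by simp
  also have "\<dots> \<le> (\<Sum>x | x\<^sup>2 \<le> n. 1 + (if x\<^sup>2 < n then 24 * real_of_int (divisor_sum (n - x\<^sup>2)) else 0))"
  proof (rule sum_mono)
    fix x assume "x \<in> {x. x\<^sup>2 \<le> n}"
    then consider "x\<^sup>2 = n" | "x\<^sup>2 < n" by fastforce
    then show "real (card (sq_reps UNIV 4 (n - x\<^sup>2)))
        \<le> 1 + (if x\<^sup>2 < n then 24 * real_of_int (divisor_sum (n - x\<^sup>2)) else 0)"
    proof cases
      case 1
      then show ?thesis by (simp add: sq_reps_at_0)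
    next
      case 2
      then have "real_of_int (int (card (four_squares (n - x\<^sup>2)))) \<le> real_of_int (24 * divisor_sum (n - x\<^sup>2))"
        unfolding of_int_le_iff by (intro card_four_squares_le) simp
      then show ?thesis using 2 by (simp add: card_sq_reps_4)
    qed
  qed
  also have "\<dots> = real (card {x. x\<^sup>2 \<le> n}) + (\<Sum>x\<in>{x. x\<^sup>2 \<le> n}. if x\<^sup>2 < n then 24 * real_of_int (divisor_sum (n - x\<^sup>2)) else 0)"
    by (simp add: sum.distrib)
  also have "(\<Sum>x\<in>{x. x\<^sup>2 \<le> n}. if x\<^sup>2 < n then 24 * real_of_int (divisor_sum (n - x\<^sup>2)) else 0)
      = 24 * (\<Sum>x | x\<^sup>2 < n. real_of_int (divisor_sum (n - x\<^sup>2)))"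
    unfolding sum_distrib_left
    by (rule sum.mono_neutral_cong_right) (use finite_bounded_squares[of "\<lambda>_. True" n] in auto)
  also have "\<dots> \<le> 24 * (3 * (1 + zeta_three_halves\<^sup>2) * n * X)"
    by (intro mult_left_mono sum_divisor_sum_shifted_squares_le \<open>X > 0\<close> Xn nX) simp
  also have "\<dots> \<le> 24 * (3 * (1 + zeta_three_halves\<^sup>2) * n * sqrt n)"
    using X assms by (intro mult_left_mono mult_nonneg_nonneg) auto
  also have "real (card {x. x\<^sup>2 \<le> n}) \<le> 2 * sqrt n + 1"
    using assms by (intro card_bounded_squares_le) simp
  also have "\<dots> \<le> 3 * (n * sqrt n)"
  proof -
    have "1 * sqrt n \<le> n * sqrt n" using assms by (intro mult_right_mono) auto
    then show ?thesis using \<open>1 \<le> sqrt n\<close> by linarith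
  qed
  finally have "real (card (sq_reps UNIV 5 n)) \<le> (72 * (1 + zeta_three_halves\<^sup>2) + 3) * (n * sqrt n)"
    by (simp add: algebra_simps)
  also have "n * sqrt n = n powr (3/2)"
    using assms powr_add[of n 1 "1/2"] by (simp add: powr_half_sqrt)
  finally show ?thesis .
qed

text \<open>Taking the first term \<open>x\<close> of the parity opposite to \<open>n\<close> makes $n - x^2$ odd, where
  \<open>Jacobi_four_squares_odd\<close> gives at least $8(n - x^2)$ representations. Restricting to $2x^2 \le n$
  makes this at least $4n$.\<close>

theorem card_five_squares_ge:
  fixes n :: int
  assumes "n > 0"
  shows "n powr (3/2) \<le> real (card (sq_reps UNIV 5 n))"
proof -
  define J where "J = \<lfloor>sqrt (real_of_int n / 8)\<rfloor>"
  have J: "J \<le> sqrt (n / 8)" "sqrt (n / 8) < J + 1" "J \<ge> 0" using assms by (simp_all add: J_def)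
  then have "real_of_int J ^ 2 \<le> sqrt (n / 8) ^ 2" by (intro power_mono) auto
  then have "real_of_int (8 * J\<^sup>2) \<le> real_of_int n" using assms by simp
  then have Jn: "8 * J\<^sup>2 \<le> n" by (simp only: of_int_le_iff)
  \<comment> \<open>For even \<open>n\<close> the value $j = 0$ yields $x = -1$, which is admissible since $n \ge 2$.\<close>
  define s :: int where "s = (if odd n then 0 else 1)"
  let ?f = "\<lambda>j. 2 * j - s"
  have *: "2 * (?f j)\<^sup>2 \<le> n \<and> odd (n - (?f j)\<^sup>2)" if "j \<in> {0..J}" for j
  proof
    show "odd (n - (?f j)\<^sup>2)" by (auto simp: s_def)
    have "j\<^sup>2 \<le> J\<^sup>2" using that by (intro power_mono) auto
    show "2 * (?f j)\<^sup>2 \<le> n"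
    proof (cases "j = 0 \<or> odd n")
      case True
      then show ?thesis using \<open>j\<^sup>2 \<le> J\<^sup>2\<close> Jn assms
        by (auto simp: s_def power_mult_distrib)
    next
      case False
      then have "(?f j)\<^sup>2 \<le> (2 * j)\<^sup>2" using that by (intro power_mono) (auto simp: s_def)
      then show ?thesis using \<open>j\<^sup>2 \<le> J\<^sup>2\<close> Jn by (simp add: power_mult_distrib)
    qed
  qed
  have "4 * real_of_int n \<le> real (card (sq_reps UNIV 4 (n - (?f j)\<^sup>2)))" if "j \<in> {0..J}" for j
  proof -
    define m where "m = n - (?f j)\<^sup>2"
    have m: "odd m" "2 * m \<ge> n" using *[OF that] by (auto simp: m_def)
    then have "m > 0" using assms by simp
    have "4 * n \<le> 8 * divisor_sum m" using le_divisor_sum[OF \<open>m > 0\<close>] m by linarith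
    also have "\<dots> = int (card (four_squares m))"
      using Jacobi_four_squares_odd[OF m(1) \<open>m > 0\<close>] by simp
    finally have "real_of_int (4 * n) \<le> real_of_int (int (card (four_squares m)))"
      by (simp only: of_int_le_iff)
    then show ?thesis by (simp add: m_def card_sq_reps_4)
  qed
  then have "(\<Sum>j\<in>{0..J}. 4 * real_of_int n) \<le> (\<Sum>j\<in>{0..J}. real (card (sq_reps UNIV 4 (n - (?f j)\<^sup>2))))"
    by (intro sum_mono) auto
  also have "\<dots> = (\<Sum>x\<in>?f ` {0..J}. real (card (sq_reps UNIV 4 (n - x\<^sup>2))))"
    by (subst sum.reindex) (auto simp: inj_on_def)
  also have "\<dots> \<le> (\<Sum>x | x\<^sup>2 \<le> n. real (card (sq_reps UNIV 4 (n - x\<^sup>2))))"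
  proof (rule sum_mono2)
    show "?f ` {0..J} \<subseteq> {x. x\<^sup>2 \<le> n}"
    proof clarify
      fix j assume "j \<in> {0..J}"
      then show "(?f j)\<^sup>2 \<le> n" using *[of j] zero_le_power2[of "?f j"] by linarith
    qed
  qed (use finite_bounded_squares[of "\<lambda>_. True" n] in auto)
  also have "\<dots> = real (card (sq_reps UNIV 5 n))"
    using card_sq_reps_Suc[of UNIV 4 n] by simp
  finally have "(J + 1) * (4 * n) \<le> real (card (sq_reps UNIV 5 n))" using J by simp
  moreover have "n powr (3/2) \<le> (J + 1) * (4 * n)"
  proof -
    have "n powr (3/2) = n * sqrt n"
      using assms powr_add[of n 1 "1/2"] by (simp add: powr_half_sqrt)
    also have "sqrt n = sqrt 8 * sqrt (n / 8)" by (simp flip: real_sqrt_mult)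
    also have "sqrt 8 * sqrt (n / 8) \<le> 4 * (real_of_int J + 1)"
    proof (rule mult_mono)
      show "sqrt 8 \<le> 4" by (rule real_le_lsqrt) auto
    qed (use J assms in auto)
    finally show ?thesis using assms by (simp add: mult_left_mono algebra_simps)
  qed
  ultimately show ?thesis by simp
qed

text \<open>One more square multiplies the count by $\sqrt{n}$ up to constants: there are $O(\sqrt{n})$ choices
  for the first term \<open>x\<close>, and for those with $2x^2 \le n$ the remainder $n - x^2$ has the same order
  as \<open>n\<close>. The induction cannot start at four squares, where $r_4(2^j) = 24$ for every $j \ge 1$.\<close>

theorem card_sq_reps_bounds:
  fixes k :: nat
  assumes "k \<ge> 5"
  shows "\<exists>c>0. \<exists>C>0. \<forall>n::int. n > 0 \<longrightarrow>
    c * n powr (k / 2 - 1) \<le> card (sq_reps UNIV k n) \<and> card (sq_reps UNIV k n) \<le> C * n powr (k / 2 - 1)"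
  using assms
proof (induction k rule: nat_induct_at_least)
  case base
  have "72 * (1 + zeta_three_halves\<^sup>2) + 3 > 0" 
    by (intro add_nonneg_pos mult_nonneg_nonneg add_nonneg_nonneg zero_le_power2) auto
  then show ?case
    using card_five_squares_le card_five_squares_ge
    by (intro exI[of _ 1] conjI exI[of _ "72 * (1 + zeta_three_halves\<^sup>2) + 3"]) auto
next
  case (Suc k)
  define a where "a = real k / 2 - 1"
  have a: "a > 0" using Suc.hyps by (simp add: a_def)
  have a': "real (Suc k) / 2 - 1 = a + 1/2" by (simp add: a_def field_simps)
  from Suc.IH obtain c C where "c > 0" "C > 0"
    and cC: "\<And>n::int. n > 0 \<Longrightarrow> c * n powr a \<le> card (sq_reps UNIV k n)"
      "\<And>n::int. n > 0 \<Longrightarrow> card (sq_reps UNIV k n) \<le> C * n powr a"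
    unfolding a_def by blast
  have "c / 2 powr (a + 1/2) * n powr (a + 1/2) \<le> card (sq_reps UNIV (Suc k) n) \<and>
      card (sq_reps UNIV (Suc k) n) \<le> 3 * (C + 1) * n powr (a + 1/2)" if n: "n > 0" for n :: int
  proof
    have rec: "real (card (sq_reps UNIV (Suc k) n)) = (\<Sum>x | x\<^sup>2 \<le> n. real (card (sq_reps UNIV k (n - x\<^sup>2))))"
      by (simp add: card_sq_reps_Suc)
    have powr_half: "n powr (a + 1/2) = sqrt n * n powr a" using n by (simp add: powr_add powr_half_sqrt)
    have "1 \<le> sqrt n" using n by simp
    have "real (card (sq_reps UNIV k (n - x\<^sup>2))) \<le> (C + 1) * n powr a" if "x\<^sup>2 \<le> n" for x
    proof (cases "x\<^sup>2 = n")
      case True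
      have "1 * 1 \<le> (C + 1) * n powr a"
        using \<open>C > 0\<close> n a by (intro mult_mono ge_one_powr_ge_zero) auto
      then show ?thesis using True by (simp add: sq_reps_at_0)
    next
      case False
      then have "real (card (sq_reps UNIV k (n - x\<^sup>2))) \<le> C * real_of_int (n - x\<^sup>2) powr a"
        using that by (intro cC) simp
      also have "\<dots> \<le> (C + 1) * n powr a"
        using that \<open>C > 0\<close> a by (intro mult_mono powr_mono2) (auto simp: zero_le_power2 simp flip: of_int_power)
      finally show ?thesis .
    qed
    then have "real (card (sq_reps UNIV (Suc k) n)) \<le> (\<Sum>x::int | x\<^sup>2 \<le> n. (C + 1) * n powr a)"
      unfolding rec by (intro sum_mono) auto
    also have "\<dots> = real (card {x::int. x\<^sup>2 \<le> n}) * ((C + 1) * n powr a)" by simp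
    also have "\<dots> \<le> (3 * sqrt n) * ((C + 1) * n powr a)"
    proof (rule mult_right_mono)
      show "real (card {x::int. x\<^sup>2 \<le> n}) \<le> 3 * sqrt n"
        using card_bounded_squares_le[of n] \<open>1 \<le> sqrt n\<close> n by linarith
    qed (use \<open>C > 0\<close> in auto)
    finally show "card (sq_reps UNIV (Suc k) n) \<le> 3 * (C + 1) * n powr (a + 1/2)"
      by (simp add: powr_half algebra_simps)
    define J where "J = \<lfloor>sqrt (real_of_int n / 2)\<rfloor>"
    have J: "J \<le> sqrt (n / 2)" "sqrt (n / 2) < J + 1" "J \<ge> 0" using n by (simp_all add: J_def)
    then have "real_of_int J ^ 2 \<le> sqrt (n / 2) ^ 2" by (intro power_mono) auto
    then have "real_of_int (2 * J\<^sup>2) \<le> real_of_int n" using n by simp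
    then have Jn: "2 * J\<^sup>2 \<le> n" by (simp only: of_int_le_iff)
    have x: "2 * x\<^sup>2 \<le> n" if "x \<in> {0..J}" for x
    proof -
      have "x\<^sup>2 \<le> J\<^sup>2" using that by (intro power_mono) auto
      then show ?thesis using Jn by simp
    qed
    have "c * (n / 2) powr a \<le> real (card (sq_reps UNIV k (n - x\<^sup>2)))" if "x \<in> {0..J}" for x
    proof -
      have "real_of_int (2 * x\<^sup>2) \<le> real_of_int n"
        using x[OF that] by (simp only: of_int_le_iff)
      then have "n / 2 \<le> real_of_int (n - x\<^sup>2)" by simp
      then have "(n / 2) powr a \<le> real_of_int (n - x\<^sup>2) powr a"
        using n a by (intro powr_mono2) auto
      then have "c * (n / 2) powr a \<le> c * real_of_int (n - x\<^sup>2) powr a" using \<open>c > 0\<close> by simp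
      also have "\<dots> \<le> real (card (sq_reps UNIV k (n - x\<^sup>2)))"
        using x[OF that] n by (intro cC) linarith
      finally show ?thesis .
    qed
    then have "(\<Sum>x\<in>{0..J}. c * (n / 2) powr a) \<le> (\<Sum>x\<in>{0..J}. real (card (sq_reps UNIV k (n - x\<^sup>2))))"
      by (intro sum_mono) auto
    also have "\<dots> \<le> real (card (sq_reps UNIV (Suc k) n))"
      unfolding rec
    proof (rule sum_mono2)
      show "{0..J} \<subseteq> {x. x\<^sup>2 \<le> n}"
      proof
        fix x assume "x \<in> {0..J}"
        then have "x\<^sup>2 \<le> n" using x[of x] zero_le_power2[of x] by linarith
        then show "x \<in> {x. x\<^sup>2 \<le> n}" by simp
      qed
    qed (use finite_bounded_squares[of "\<lambda>_. True" n] in auto)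
    finally have "(J + 1) * (c * (n / 2) powr a) \<le> real (card (sq_reps UNIV (Suc k) n))" using J by simp
    moreover have "c / 2 powr (a + 1/2) * n powr (a + 1/2) = sqrt (n / 2) * (c * (n / 2) powr a)"
      using n by (simp add: powr_divide powr_add powr_half_sqrt real_sqrt_divide mult_ac)
    moreover have "sqrt (n / 2) * (c * (n / 2) powr a) \<le> (J + 1) * (c * (n / 2) powr a)"
      using J \<open>c > 0\<close> by (intro mult_right_mono) auto
    ultimately show "c / 2 powr (a + 1/2) * n powr (a + 1/2) \<le> card (sq_reps UNIV (Suc k) n)" by simp
  qed
  then show ?case unfolding a' using \<open>c > 0\<close> \<open>C > 0\<close>
    by (intro exI[of _ "c / 2 powr (a + 1/2)"] conjI exI[of _ "3 * (C + 1)"]) auto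
qed

section \<open>Lattice points as integer-valued functions\<close>

definition int_vec :: "('d::finite \<Rightarrow> int) \<Rightarrow> real ^ 'd" where
  "int_vec f = (\<chi> i. of_int (f i))"

lemma int_vec_nth [simp]: "int_vec f $ i = of_int (f i)"
  by (simp add: int_vec_def)

lemma inj_int_vec: "inj int_vec"
  by (auto simp: inj_def vec_eq_iff)

lemma int_lattice_eq: "(int_lattice :: (real ^ 'd) set) = range int_vec"
proof (intro equalityI subsetI)
  fix v :: "real ^ 'd" assume "v \<in> int_lattice"
  then have "v = int_vec (\<lambda>i. \<lfloor>v $ i\<rfloor>)"
    by (auto simp: int_lattice_def vec_eq_iff Ints_def)
  then show "v \<in> range int_vec" by blast
qed (auto simp: int_lattice_def)

lemma lattice_cube_eq: "(lattice_cube N :: (real ^ 'd) set) = int_vec ` {f. \<forall>i. \<bar>f i\<bar> \<le> int N}"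
proof -
  have "int_vec f \<in> cbox (\<chi> i. - real N) (\<chi> i. real N) \<longleftrightarrow> (\<forall>i. \<bar>f i\<bar> \<le> int N)" for f :: "'d \<Rightarrow> int"
  proof -
    have "int_vec f \<in> cbox (\<chi> i. - real N) (\<chi> i. real N) \<longleftrightarrow>
        (\<forall>i. real_of_int (- int N) \<le> of_int (f i) \<and> real_of_int (f i) \<le> of_int (int N))"
      by (simp add: mem_box_cart)
    also have "\<dots> \<longleftrightarrow> (\<forall>i. \<bar>f i\<bar> \<le> int N)"
      unfolding of_int_le_iff by (auto simp: abs_le_iff minus_le_iff)
    finally show ?thesis .
  qed
  then show ?thesis unfolding lattice_cube_def int_lattice_eq by blast
qed

lemma norm_int_vec: "(norm (int_vec f))\<^sup>2 = of_int (\<Sum>i\<in>UNIV. (f i)\<^sup>2)"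
  unfolding power2_norm_eq_inner by (simp add: inner_vec_def power2_eq_square)

lemma lattice_sphere_eq: "(lattice_sphere lam :: (real ^ 'd) set) = int_vec ` {f. (\<Sum>i\<in>UNIV. (f i)\<^sup>2) = int lam}"
proof -
  have "(norm (int_vec f))\<^sup>2 = real lam \<longleftrightarrow> (\<Sum>i\<in>UNIV. (f i)\<^sup>2) = int lam" for f :: "'d \<Rightarrow> int"
    unfolding norm_int_vec by (metis of_int_eq_iff of_int_of_nat_eq)
  then show ?thesis unfolding lattice_sphere_def int_lattice_eq by blast
qed

lemma card_box_functions:
  fixes A :: "'d::finite \<Rightarrow> int set"
  shows "card {f. \<forall>i. f i \<in> A i} = (\<Prod>i\<in>UNIV. card (A i))"
  using card_PiE[of UNIV A] by (simp add: PiE_def Pi_def)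

lemma card_lattice_cube: "card (lattice_cube N :: (real ^ 'd) set) = (2 * N + 1) ^ CARD('d)"
proof -
  have "card (lattice_cube N :: (real ^ 'd) set) = card {f :: 'd \<Rightarrow> int. \<forall>i. f i \<in> {- int N..int N}}"
    unfolding lattice_cube_eq
    by (subst card_image) (auto intro: inj_on_subset[OF inj_int_vec] arg_cong[of _ _ card] simp: abs_le_iff minus_le_iff)
  also have "\<dots> = (2 * N + 1) ^ CARD('d)" unfolding card_box_functions by (simp add: nat_add_distrib nat_mult_distrib)
  finally show ?thesis .
qed

lemma finite_lattice_cube: "finite (lattice_cube N :: (real ^ 'd) set)"
  by (rule card_ge_0_finite) (simp add: card_lattice_cube)

text \<open>An enumeration \<open>h\<close> of the coordinates turns integer vectors into lists of length $d$.\<close>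

lemma bij_betw_lattice_sphere_sq_reps:
  "\<exists>F. bij_betw F (lattice_sphere lam :: (real ^ 'd) set) (sq_reps UNIV CARD('d) (int lam))"
proof -
  obtain h where h: "bij_betw h {..<CARD('d)} (UNIV :: 'd set)"
    using ex_bij_betw_nat_finite[of "UNIV :: 'd set"] by (auto simp: atLeast0LessThan)
  let ?R = "{f :: 'd \<Rightarrow> int. (\<Sum>i\<in>UNIV. (f i)\<^sup>2) = int lam}"
  have sum_h: "(\<Sum>i\<in>UNIV. g i) = (\<Sum>k<CARD('d). g (h k))" for g :: "'d \<Rightarrow> int"
    using sum.reindex_bij_betw[OF h, of g] by simp
  define h' where "h' = the_inv_into {..<CARD('d)} h"
  have h': "h' i < CARD('d)" "h (h' i) = i" for i
    using h the_inv_into_into[of h "{..<CARD('d)}" i] f_the_inv_into_f_bij_betw[OF h, of i]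
    by (auto simp: h'_def bij_betw_def)
  have h'h: "h' (h k) = k" if "k < CARD('d)" for k
    using h that the_inv_into_f_f[of h "{..<CARD('d)}" k] by (simp add: h'_def bij_betw_def)
  have "bij_betw (\<lambda>f. map (f \<circ> h) [0..<CARD('d)]) ?R (sq_reps UNIV CARD('d) (int lam))"
  proof (rule bij_betw_byWitness[where f' = "\<lambda>xs i. xs ! h' i"])
    show "\<forall>f\<in>?R. (\<lambda>i. map (f \<circ> h) [0..<CARD('d)] ! h' i) = f"
      using h' by auto
    show "\<forall>xs\<in>sq_reps UNIV CARD('d) (int lam). map ((\<lambda>i. xs ! h' i) \<circ> h) [0..<CARD('d)] = xs"
      using h'h by (auto simp: sq_reps_def intro!: nth_equalityI)
    show "(\<lambda>f. map (f \<circ> h) [0..<CARD('d)]) ` ?R \<subseteq> sq_reps UNIV CARD('d) (int lam)"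
      by (auto simp: sq_reps_def sum_h interv_sum_list_conv_sum_set_nat atLeast0LessThan o_def)
    show "(\<lambda>xs i. xs ! h' i) ` sq_reps UNIV CARD('d) (int lam) \<subseteq> ?R"
    proof clarify
      fix xs :: "int list" assume "xs \<in> sq_reps UNIV CARD('d) (int lam)"
      then have "length xs = CARD('d)" "(\<Sum>k<CARD('d). (xs ! k)\<^sup>2) = int lam"
        by (auto simp: sq_reps_def sum_list_sum_nth atLeast0LessThan)
      then show "(\<Sum>i\<in>UNIV. (xs ! h' i)\<^sup>2) = int lam" by (simp add: sum_h h'h)
    qed
  qed
  moreover have "bij_betw (the_inv_into ?R int_vec) (lattice_sphere lam) ?R"
    unfolding lattice_sphere_eq by (rule bij_betw_the_inv_into) (auto intro!: bij_betw_imageI inj_on_subset[OF inj_int_vec])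
  ultimately show ?thesis by (blast intro: bij_betw_trans)
qed

lemma card_lattice_sphere:
  "card (lattice_sphere lam :: (real ^ 'd) set) = card (sq_reps UNIV CARD('d) (int lam))"
  using bij_betw_lattice_sphere_sq_reps bij_betw_same_card by blast

lemma finite_lattice_sphere: "finite (lattice_sphere lam :: (real ^ 'd) set)"
  using bij_betw_lattice_sphere_sq_reps[where 'd = 'd, of lam] bij_betw_finite finite_sq_reps by blast

section \<open>Edges of the distance graph\<close>

text \<open>The bound on \<open>lam\<close> makes every coordinate of $qv$ at most \<open>N\<close> in absolute value for \<open>v\<close> on the
  sphere. So if each coordinate of \<open>x\<close> is at most \<open>N\<close> in absolute value and of sign opposite to that
  of the same coordinate of \<open>v\<close>, the edge from \<open>x\<close> to $x + qv$ stays inside the cube. This leaves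
  $N + 1$ choices for each coordinate.\<close>

lemma card_edges_ge:
  fixes N lam q :: nat
  assumes q: "q \<ge> 1" and lam: "real lam \<le> (1 / real q ^ 2) * (real N)\<^sup>2"
  defines "Q \<equiv> lattice_cube N :: (real ^ 'd) set"
  defines "S \<equiv> lattice_sphere lam :: (real ^ 'd) set"
  shows "(N + 1) ^ CARD('d) * card S \<le> card (parcs (dist_graph q lam N :: (real ^ 'd) pair_pre_digraph))"
proof -
  let ?E = "parcs (dist_graph q lam N :: (real ^ 'd) pair_pre_digraph)"
  let ?A = "\<lambda>v. {x \<in> Q. x + real q *\<^sub>R v \<in> Q}"
  have E: "?E = (\<lambda>(v, x). (x, x + real q *\<^sub>R v)) ` (SIGMA v:S. ?A v)"
    by (force simp: dist_graph_def Q_def S_def algebra_simps image_iff)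
  have "inj_on (\<lambda>(v, x). (x, x + real q *\<^sub>R v)) (SIGMA v:S. ?A v)"
    using q by (auto simp: inj_on_def)
  then have "card ?E = card (SIGMA v:S. ?A v)" unfolding E by (rule card_image)
  also have "\<dots> = (\<Sum>v\<in>S. card (?A v))"
    by (rule card_SigmaI) (auto simp: S_def Q_def finite_lattice_sphere intro: finite_subset[OF _ finite_lattice_cube])
  also have "\<dots> \<ge> (\<Sum>v\<in>S. (N + 1) ^ CARD('d))"
  proof (rule sum_mono)
    fix v assume "v \<in> S"
    then obtain f where v: "v = int_vec f" and f: "(\<Sum>i\<in>UNIV. (f i)\<^sup>2) = int lam"
      unfolding S_def lattice_sphere_eq by blast
    have qf: "int q * \<bar>f i\<bar> \<le> int N" for i
    proof -
      have "(f i)\<^sup>2 \<le> int lam" unfolding f[symmetric] by (rule member_le_sum) auto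
      then have "(real_of_int (f i))\<^sup>2 \<le> real lam" by (metis of_int_le_iff of_int_of_nat_eq of_int_power)
      also note lam
      finally have "(real q)\<^sup>2 * (real_of_int (f i))\<^sup>2 \<le> (real N)\<^sup>2" using q by (simp add: field_simps)
      then have "(real q * \<bar>real_of_int (f i)\<bar>)\<^sup>2 \<le> (real N)\<^sup>2" by (simp add: power_mult_distrib)
      then have "real q * \<bar>real_of_int (f i)\<bar> \<le> real N" by (rule power2_le_imp_le) simp
      then have "real_of_int (int q * \<bar>f i\<bar>) \<le> real_of_int (int N)" by simp
      then show ?thesis by (simp only: of_int_le_iff)
    qed
    let ?B = "\<lambda>i. if f i \<ge> 0 then {- int N..0} else {0..int N}"
    have "card {g. \<forall>i. g i \<in> ?B i} = (N + 1) ^ CARD('d)"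
    proof -
      have "card (?B i) = N + 1" for i by (simp add: nat_add_distrib)
      then show ?thesis unfolding card_box_functions by (simp only: prod_constant)
    qed
    then have "(N + 1) ^ CARD('d) = card (int_vec ` {g. \<forall>i. g i \<in> ?B i})"
      by (subst card_image) (auto intro: inj_on_subset[OF inj_int_vec])
    also have "\<dots> \<le> card (?A v)"
    proof (rule card_mono)
      show "finite (?A v)" by (auto simp: Q_def intro: finite_subset[OF _ finite_lattice_cube])
      show "int_vec ` {g. \<forall>i. g i \<in> ?B i} \<subseteq> ?A v"
      proof (clarify, intro conjI)
        fix g assume g: "\<forall>i. g i \<in> ?B i"
        have gb: "\<bar>g i\<bar> \<le> int N \<and> \<bar>g i + int q * f i\<bar> \<le> int N" for i
        proof -
          show ?thesis
          proof (cases "f i \<ge> 0")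
            case True
            then have "0 \<le> int q * f i" "int q * f i \<le> int N" using qf[of i] by simp_all
            moreover have "- int N \<le> g i" "g i \<le> 0" using True g[rule_format, of i] by simp_all
            ultimately show ?thesis unfolding abs_le_iff by linarith
          next
            case False
            then have "int q * f i \<le> 0" "- int N \<le> int q * f i"
              using qf[of i] by (simp_all add: mult_nonneg_nonpos)
            moreover have "0 \<le> g i" "g i \<le> int N" using False g[rule_format, of i] by simp_all
            ultimately show ?thesis unfolding abs_le_iff by linarith
          qed
        qed
        then show "int_vec g \<in> Q" unfolding Q_def lattice_cube_eq by blast
        have "int_vec g + real q *\<^sub>R v = int_vec (\<lambda>i. g i + int q * f i)"
          by (simp add: v vec_eq_iff)
        then show "int_vec g + real q *\<^sub>R v \<in> Q"
          using gb unfolding Q_def lattice_cube_eq by blast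
      qed
    qed
    finally show "(N + 1) ^ CARD('d) \<le> card (?A v)" .
  qed
  finally show ?thesis by (simp add: mult.commute)
qed

lemma deg_into_le_card_sphere:
  "deg_into (dist_graph q lam N :: (real ^ 'd) pair_pre_digraph) x U \<le> card (lattice_sphere lam :: (real ^ 'd) set)"
proof -
  have "{y \<in> U. (x, y) \<in> parcs (dist_graph q lam N :: (real ^ 'd) pair_pre_digraph)}
      \<subseteq> (\<lambda>v. x + real q *\<^sub>R v) ` lattice_sphere lam"
    by (force simp: dist_graph_def algebra_simps)
  then have "deg_into (dist_graph q lam N :: (real ^ 'd) pair_pre_digraph) x U
      \<le> card ((\<lambda>v. x + real q *\<^sub>R v) ` (lattice_sphere lam :: (real ^ 'd) set))"
    unfolding deg_into_def by (intro card_mono finite_imageI finite_lattice_sphere)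
  also have "\<dots> \<le> card (lattice_sphere lam :: (real ^ 'd) set)" by (intro card_image_le finite_lattice_sphere)
  finally show ?thesis .
qed

lemma card_edges_le:
  "card (parcs (dist_graph q lam N :: (real ^ 'd) pair_pre_digraph))
    \<le> card (lattice_cube N :: (real ^ 'd) set) * card (lattice_sphere lam :: (real ^ 'd) set)"
proof -
  let ?G = "dist_graph q lam N :: (real ^ 'd) pair_pre_digraph" and ?Q = "lattice_cube N :: (real ^ 'd) set"
  have E: "parcs ?G = (SIGMA x:?Q. {y \<in> ?Q. (x, y) \<in> parcs ?G})"
    by (auto simp: dist_graph_def)
  have "card (parcs ?G) = card (SIGMA x:?Q. {y \<in> ?Q. (x, y) \<in> parcs ?G})"
    by (rule arg_cong[OF E])
  also have "\<dots> = (\<Sum>x\<in>?Q. deg_into ?G x ?Q)"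
    unfolding deg_into_def by (rule card_SigmaI) (simp_all add: finite_lattice_cube)
  also have "\<dots> \<le> (\<Sum>x\<in>?Q. card (lattice_sphere lam :: (real ^ 'd) set))"
    by (intro sum_mono deg_into_le_card_sphere)
  finally show ?thesis by simp
qed

section \<open>Second moments of degrees into a random subset\<close>

text \<open>The exponent \<open>card {y, z}\<close> treats the independent case $y \ne z$ and the case $y = z$ at once.\<close>

lemma prob_retain_pair:
  assumes "finite A" "y \<in> A" "z \<in> A" "0 \<le> \<theta>" "\<theta> \<le> 1"
  shows "measure_pmf.prob (Pi_pmf A False (\<lambda>_. bernoulli_pmf \<theta>)) {f. f y \<and> f z} = \<theta> ^ card {y, z}"
proof -
  let ?B = "\<lambda>x. if x \<in> {y, z} then {True} else UNIV"
  have "{f. f y \<and> f z} = Pi A ?B" using assms by (auto simp: Pi_def)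
  then have "measure_pmf.prob (Pi_pmf A False (\<lambda>_. bernoulli_pmf \<theta>)) {f. f y \<and> f z}
      = (\<Prod>x\<in>A. measure_pmf.prob (bernoulli_pmf \<theta>) (?B x))"
    using measure_Pi_pmf_Pi[OF \<open>finite A\<close>] by simp
  also have "\<dots> = (\<Prod>x\<in>A. if x \<in> {y, z} then \<theta> else 1)"
    using assms by (intro prod.cong) (auto simp: measure_pmf_single)
  also have "\<dots> = (\<Prod>x\<in>{y, z}. \<theta>)"
    by (rule prod.mono_neutral_cong_right) (use assms in auto)
  finally show ?thesis by simp
qed

text \<open>The square of the number of retained points counts ordered pairs of them; the diagonal pairs are
  the source of the linear term.\<close>

lemma expectation_square_card_binomial_subset:
  assumes "finite A" "B \<subseteq> A" "0 \<le> \<theta>" "\<theta> \<le> 1"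
  shows "measure_pmf.expectation (binomial_subset A \<theta>) (\<lambda>R. (real (card (R \<inter> B)))\<^sup>2)
    \<le> \<theta>\<^sup>2 * (real (card B))\<^sup>2 + \<theta> * real (card B)"
proof -
  let ?M = "Pi_pmf A False (\<lambda>_. bernoulli_pmf \<theta>)"
  have "finite B" using assms by (blast intro: finite_subset)
  have sq: "(real (card ({x \<in> A. f x} \<inter> B)))\<^sup>2 = (\<Sum>y\<in>B. \<Sum>z\<in>B. indicator {f. f y \<and> f z} f)" for f
  proof -
    have "real (card ({x \<in> A. f x} \<inter> B)) = (\<Sum>y\<in>B. of_bool (f y))"
    proof -
      have "{x \<in> A. f x} \<inter> B = B \<inter> {y. f y}" using assms(2) by auto
      then show ?thesis using \<open>finite B\<close> by (simp add: sum_of_bool_eq)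
    qed
    then show ?thesis by (simp add: power2_eq_square sum_product indicator_def of_bool_conj)
  qed
  have "measure_pmf.expectation (binomial_subset A \<theta>) (\<lambda>R. (real (card (R \<inter> B)))\<^sup>2)
      = measure_pmf.expectation ?M (\<lambda>f. \<Sum>y\<in>B. \<Sum>z\<in>B. indicator {f. f y \<and> f z} f)"
    unfolding binomial_subset_def integral_map_pmf sq ..
  also have "\<dots> = (\<Sum>y\<in>B. \<Sum>z\<in>B. measure_pmf.prob ?M {f. f y \<and> f z})"
  proof -
    have int: "integrable ?M (indicat_real X)" for X
      by (rule measure_pmf.integrable_const_bound[where B = 1]) (auto simp: indicator_def)
    have "measure_pmf.expectation ?M (\<lambda>f. \<Sum>y\<in>B. \<Sum>z\<in>B. indicat_real {f. f y \<and> f z} f)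
        = (\<Sum>y\<in>B. measure_pmf.expectation ?M (\<lambda>f. \<Sum>z\<in>B. indicat_real {f. f y \<and> f z} f))"
      by (rule Bochner_Integration.integral_sum) (intro Bochner_Integration.integrable_sum int)
    also have "\<dots> = (\<Sum>y\<in>B. \<Sum>z\<in>B. measure_pmf.expectation ?M (indicat_real {f. f y \<and> f z}))"
      by (intro sum.cong refl, rule Bochner_Integration.integral_sum, rule int)
    finally show ?thesis by simp
  qed
  also have "\<dots> = (\<Sum>y\<in>B. \<Sum>z\<in>B. \<theta> ^ card {y, z})"
    using assms by (intro sum.cong prob_retain_pair) auto
  also have "\<dots> \<le> (\<Sum>y\<in>B. \<Sum>z\<in>B. \<theta>\<^sup>2 + (if z = y then \<theta> else 0))"
    using assms by (intro sum_mono) (auto simp: card_insert_if power2_eq_square)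
  also have "\<dots> = \<theta>\<^sup>2 * (real (card B))\<^sup>2 + \<theta> * real (card B)"
    using \<open>finite B\<close> by (simp add: sum.distrib power2_eq_square algebra_simps)
  finally show ?thesis .
qed

lemma integrable_binomial_subset:
  fixes g :: "'a set \<Rightarrow> real"
  assumes "finite A"
  shows "integrable (measure_pmf (binomial_subset A \<theta>)) g"
proof (rule integrable_measure_pmf_finite)
  have "set_pmf (binomial_subset A \<theta>) \<subseteq> Pow A" by (auto simp: binomial_subset_def)
  then show "finite (set_pmf (binomial_subset A \<theta>))" using assms by (meson finite_Pow_iff finite_subset)
qed

text \<open>Once the expected degree $\theta D$ is at least $1$, the linear diagonal term is dominated by the
  quadratic one.\<close>

lemma expectation_sum_deg_square_le:
  fixes G :: "'a pair_pre_digraph"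
  assumes "finite Q" "0 \<le> \<theta>" "\<theta> \<le> 1" "\<And>x. deg_into G x Q \<le> D" "1 \<le> \<theta> * real D"
  shows "measure_pmf.expectation (binomial_subset Q \<theta>) (\<lambda>R. \<Sum>x\<in>Q. (real (deg_into G x R))\<^sup>2)
    \<le> 2 * \<theta>\<^sup>2 * (real D)\<^sup>2 * real (card Q)"
proof -
  let ?B = "\<lambda>x. {y \<in> Q. (x, y) \<in> parcs G}"
  have "measure_pmf.expectation (binomial_subset Q \<theta>) (\<lambda>R. \<Sum>x\<in>Q. (real (deg_into G x R))\<^sup>2)
      = (\<Sum>x\<in>Q. measure_pmf.expectation (binomial_subset Q \<theta>) (\<lambda>R. (real (deg_into G x R))\<^sup>2))"
    by (rule Bochner_Integration.integral_sum) (rule integrable_binomial_subset[OF assms(1)])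
  also have "\<dots> = (\<Sum>x\<in>Q. measure_pmf.expectation (binomial_subset Q \<theta>) (\<lambda>R. (real (card (R \<inter> ?B x)))\<^sup>2))"
  proof (intro sum.cong refl integral_cong_AE)
    fix x
    have "AE R in measure_pmf (binomial_subset Q \<theta>). R \<subseteq> Q"
      by (auto simp: AE_measure_pmf_iff binomial_subset_def)
    then show "AE R in measure_pmf (binomial_subset Q \<theta>). (real (deg_into G x R))\<^sup>2 = (real (card (R \<inter> ?B x)))\<^sup>2"
    proof eventually_elim
      case (elim R)
      then have "{y \<in> R. (x, y) \<in> parcs G} = R \<inter> ?B x" by auto
      then show ?case by (simp add: deg_into_def)
    qed
  qed simp_all
  also have "\<dots> \<le> (\<Sum>x\<in>Q. 2 * \<theta>\<^sup>2 * (real D)\<^sup>2)"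
  proof (rule sum_mono)
    fix x
    have cB: "real (card (?B x)) \<le> real D" using assms(4)[of x] by (simp add: deg_into_def)
    have "measure_pmf.expectation (binomial_subset Q \<theta>) (\<lambda>R. (real (card (R \<inter> ?B x)))\<^sup>2)
        \<le> \<theta>\<^sup>2 * (real (card (?B x)))\<^sup>2 + \<theta> * real (card (?B x))"
      by (rule expectation_square_card_binomial_subset) (use assms in auto)
    also have "\<dots> \<le> \<theta>\<^sup>2 * (real D)\<^sup>2 + \<theta> * real D"
      using cB assms by (intro add_mono mult_left_mono power_mono) auto
    also have "\<theta> * real D \<le> (\<theta> * real D)\<^sup>2"
      using assms(5) self_le_power[of "\<theta> * real D" 2] by simp
    finally show "measure_pmf.expectation (binomial_subset Q \<theta>) (\<lambda>R. (real (card (R \<inter> ?B x)))\<^sup>2)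
        \<le> 2 * \<theta>\<^sup>2 * (real D)\<^sup>2"
      by (simp add: power_mult_distrib)
  qed
  finally show ?thesis by (simp add: mult.commute)
qed

theorem lemma4p1:
  assumes "CARD('d::finite) \<ge> 5"
  shows
   "\<exists>C\<^sub>S>0. \<forall>q::nat. q \<ge> 1 \<longrightarrow>
     (\<exists>c\<^sub>0>0. \<exists>c\<^sub>1>0. \<exists>c\<^sub>2>0. \<exists>C\<^sub>E>0.
       \<forall>(\<gamma>::real) (N::nat) (lam::nat).
         0 < \<gamma> \<and> \<gamma> < real CARD('d) - 2 \<and> N \<ge> 1 \<and>
         c\<^sub>1 * retention_prob \<gamma> N powr (- 2 / (real CARD('d) - 2)) \<le> real lam \<and>
         real lam \<le> c\<^sub>2 * (real N)\<^sup>2 \<longrightarrow>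
         (let d = real CARD('d);
              p = retention_prob \<gamma> N;
              Q = lattice_cube N :: (real ^ 'd) set;
              S = lattice_sphere lam :: (real ^ 'd) set;
              G = dist_graph q lam N :: (real ^ 'd) pair_pre_digraph;
              E = parcs G
          in
            comparable_within C\<^sub>S (real (card S)) (real lam powr (d / 2 - 1)) \<and>
            comparable_within C\<^sub>E (real (card E)) (real (card Q) * real (card S)) \<and>
            p * real (card S) \<ge> 1 \<and>
            (\<forall>\<theta>. p \<le> \<theta> \<and> \<theta> \<le> 1 \<longrightarrow>
               measure_pmf.expectation (binomial_subset Q \<theta>)
                 (\<lambda>Q\<^sub>\<theta>. \<Sum>x\<in>Q. (real (deg_into G x Q\<^sub>\<theta>))\<^sup>2)
               \<le> c\<^sub>0 * \<theta>\<^sup>2 * ((real (card E))\<^sup>2 / real (card Q)))))"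
proof -
  define d where "d = real CARD('d)"
  have d: "d \<ge> 5" using assms by (simp add: d_def)
  obtain c C where "c > 0" "C > 0" and sphere:
    "\<And>n::int. n > 0 \<Longrightarrow> c * n powr (d / 2 - 1) \<le> card (sq_reps UNIV CARD('d) n)"
    "\<And>n::int. n > 0 \<Longrightarrow> card (sq_reps UNIV CARD('d) n) \<le> C * n powr (d / 2 - 1)"
    using card_sq_reps_bounds[OF assms] unfolding d_def by blast
  define C\<^sub>S where "C\<^sub>S = max C (1 / c)"
  \<comment> \<open>Chosen so that $c\lambda^{d/2-1} \ge 1/p$ whenever $\lambda \ge c_1p^{-2/(d-2)}$, and at least $1$ so that $\lambda > 0$.\<close>
  define c\<^sub>1 where "c\<^sub>1 = max 1 ((1 / c) powr (2 / (d - 2)))"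
  define C\<^sub>E :: real where "C\<^sub>E = 2 ^ CARD('d)"
  have C\<^sub>S: "C\<^sub>S > 0" "inverse C\<^sub>S \<le> c" "C \<le> C\<^sub>S"
  proof -
    show "C\<^sub>S > 0" "C \<le> C\<^sub>S" using \<open>C > 0\<close> by (auto simp: C\<^sub>S_def)
    then have "inverse C\<^sub>S \<le> inverse (1 / c)" using \<open>c > 0\<close> by (intro le_imp_inverse_le) (auto simp: C\<^sub>S_def)
    then show "inverse C\<^sub>S \<le> c" by simp
  qed
  have main: "comparable_within C\<^sub>S (real (card S)) (real lam powr (d / 2 - 1)) \<and>
      comparable_within C\<^sub>E (real (card (parcs G))) (real (card Q) * real (card S)) \<and>
      p * real (card S) \<ge> 1 \<and>
      (\<forall>\<theta>. p \<le> \<theta> \<and> \<theta> \<le> 1 \<longrightarrow>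
         measure_pmf.expectation (binomial_subset Q \<theta>) (\<lambda>R. \<Sum>x\<in>Q. (real (deg_into G x R))\<^sup>2)
         \<le> 2 * C\<^sub>E\<^sup>2 * \<theta>\<^sup>2 * ((real (card (parcs G)))\<^sup>2 / real (card Q)))"
    if q: "q \<ge> 1" and \<gamma>: "0 < \<gamma>" "\<gamma> < d - 2" and N: "N \<ge> 1"
      and lam: "c\<^sub>1 * p powr (- 2 / (d - 2)) \<le> real lam" "real lam \<le> (1 / real q ^ 2) * (real N)\<^sup>2"
      and defs: "p = retention_prob \<gamma> N" "Q = lattice_cube N" "S = lattice_sphere lam" "G = dist_graph q lam N"
    for \<gamma> p :: real and q N lam :: nat and Q S :: "(real ^ 'd) set" and G :: "(real ^ 'd) pair_pre_digraph"
  proof -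
    have p: "p > 0" "p \<le> 1"
      using N \<gamma> by (auto simp: defs retention_prob_def powr_minus inverse_le_1_iff ge_one_powr_ge_zero)
    have "1 * 1 \<le> c\<^sub>1 * p powr (- 2 / (d - 2))"
    proof (rule mult_mono)
      have "(1::real) = 1 powr (- 2 / (d - 2))" by simp
      also have "\<dots> \<le> p powr (- 2 / (d - 2))" using p d by (intro powr_mono2') auto
      finally show "1 \<le> p powr (- 2 / (d - 2))" .
    qed (auto simp: c\<^sub>1_def)
    then have "lam > 0" using lam(1) by (cases "lam = 0") auto
    have S_ge: "c * real lam powr (d / 2 - 1) \<le> real (card S)"
      and S_le: "real (card S) \<le> C * real lam powr (d / 2 - 1)"
      using sphere[of "int lam"] \<open>lam > 0\<close> by (auto simp: defs card_lattice_sphere)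
    have "inverse C\<^sub>S * real lam powr (d / 2 - 1) \<le> c * real lam powr (d / 2 - 1)"
      "C * real lam powr (d / 2 - 1) \<le> C\<^sub>S * real lam powr (d / 2 - 1)"
      using C\<^sub>S by (auto intro: mult_right_mono)
    then have conj1: "comparable_within C\<^sub>S (real (card S)) (real lam powr (d / 2 - 1))"
      using S_ge S_le unfolding comparable_within_def by linarith
    have cardQ: "real (card Q) > 0" "real (card Q) \<le> C\<^sub>E * real ((N + 1) ^ CARD('d))"
    proof -
      show "real (card Q) > 0" by (simp add: defs card_lattice_cube)
      have "real (2 * N + 1) ^ CARD('d) \<le> (2 * real (N + 1)) ^ CARD('d)" by (intro power_mono) auto
      then show "real (card Q) \<le> C\<^sub>E * real ((N + 1) ^ CARD('d))"
        by (simp only: defs card_lattice_cube C\<^sub>E_def power_mult_distrib of_nat_power)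
    qed
    have "C\<^sub>E \<ge> 1" by (simp add: C\<^sub>E_def)
    have E_ge: "real (card Q) * real (card S) \<le> C\<^sub>E * real (card (parcs G))"
    proof -
      have "real (card Q) * real (card S) \<le> (C\<^sub>E * real ((N + 1) ^ CARD('d))) * real (card S)"
        using cardQ by (intro mult_right_mono) auto
      also have "\<dots> = C\<^sub>E * real ((N + 1) ^ CARD('d) * card S)" by simp
      also have "\<dots> \<le> C\<^sub>E * real (card (parcs G))"
        unfolding defs using card_edges_ge[OF q lam(2), where 'd = 'd] \<open>C\<^sub>E \<ge> 1\<close>
        by (intro mult_left_mono of_nat_mono) auto
      finally show ?thesis .
    qed
    have conj2: "comparable_within C\<^sub>E (real (card (parcs G))) (real (card Q) * real (card S))"
      unfolding comparable_within_def
    proof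
      show "inverse C\<^sub>E * (real (card Q) * real (card S)) \<le> real (card (parcs G))"
        using E_ge \<open>C\<^sub>E \<ge> 1\<close> by (simp add: field_simps)
      have "real (card (parcs G)) \<le> real (card Q * card S)"
        unfolding defs by (intro of_nat_mono card_edges_le)
      also have "\<dots> \<le> C\<^sub>E * (real (card Q) * real (card S))"
        using mult_right_mono[OF \<open>C\<^sub>E \<ge> 1\<close>, of "real (card Q) * real (card S)"] by simp
      finally show "real (card (parcs G)) \<le> C\<^sub>E * (real (card Q) * real (card S))" .
    qed
    have conj3: "p * real (card S) \<ge> 1"
    proof -
      have "(1 / c) powr (2 / (d - 2)) * p powr (- 2 / (d - 2)) \<le> c\<^sub>1 * p powr (- 2 / (d - 2))"
        by (intro mult_right_mono) (auto simp: c\<^sub>1_def)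
      also note lam(1)
      finally have "((1 / c) powr (2 / (d - 2)) * p powr (- 2 / (d - 2))) powr (d / 2 - 1) \<le> real lam powr (d / 2 - 1)"
        using d by (intro powr_mono2) auto
      moreover have "((1 / c) powr (2 / (d - 2)) * p powr (- 2 / (d - 2))) powr (d / 2 - 1) = 1 / c * (1 / p)"
      proof -
        have "2 / (d - 2) * (d / 2 - 1) = 1" "- 2 / (d - 2) * (d / 2 - 1) = -1" using d by (simp_all add: field_simps)
        then have "((1 / c) powr (2 / (d - 2))) powr (d / 2 - 1) = 1 / c"
          "(p powr (- 2 / (d - 2))) powr (d / 2 - 1) = 1 / p"
          unfolding powr_powr using p \<open>c > 0\<close> by (simp_all add: powr_minus_divide)
        then show ?thesis using powr_mult[of "(1 / c) powr (2 / (d - 2))" "p powr (- 2 / (d - 2))" "d / 2 - 1"] by simp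
      qed
      ultimately have "1 / c * (1 / p) \<le> real lam powr (d / 2 - 1)" by (simp only:)
      then have "1 \<le> p * (c * real lam powr (d / 2 - 1))" using p \<open>c > 0\<close> by (simp add: field_simps)
      also have "\<dots> \<le> p * real (card S)" using S_ge p by (intro mult_left_mono) auto
      finally show ?thesis .
    qed
    have conj4: "measure_pmf.expectation (binomial_subset Q \<theta>) (\<lambda>R. \<Sum>x\<in>Q. (real (deg_into G x R))\<^sup>2)
         \<le> 2 * C\<^sub>E\<^sup>2 * \<theta>\<^sup>2 * ((real (card (parcs G)))\<^sup>2 / real (card Q))" if "p \<le> \<theta>" "\<theta> \<le> 1" for \<theta>
    proof -
      have "p * real (card S) \<le> \<theta> * real (card S)" using that by (intro mult_right_mono) auto
      then have "1 \<le> \<theta> * real (card S)" using conj3 by linarith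
      then have "measure_pmf.expectation (binomial_subset Q \<theta>) (\<lambda>R. \<Sum>x\<in>Q. (real (deg_into G x R))\<^sup>2)
          \<le> 2 * \<theta>\<^sup>2 * (real (card S))\<^sup>2 * real (card Q)"
        using that p unfolding defs
        by (intro expectation_sum_deg_square_le deg_into_le_card_sphere finite_lattice_cube) auto
      also have "(real (card S))\<^sup>2 * real (card Q) = (real (card Q) * real (card S))\<^sup>2 / real (card Q)"
        using cardQ by (simp add: power2_eq_square)
      then have "2 * \<theta>\<^sup>2 * (real (card S))\<^sup>2 * real (card Q) = 2 * \<theta>\<^sup>2 * ((real (card Q) * real (card S))\<^sup>2 / real (card Q))"
        by (simp only: mult.assoc)
      also have "\<dots> \<le> 2 * \<theta>\<^sup>2 * ((C\<^sub>E * real (card (parcs G)))\<^sup>2 / real (card Q))"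
        using E_ge by (intro mult_left_mono divide_right_mono power_mono) auto
      finally show ?thesis by (simp add: power_mult_distrib mult_ac)
    qed
    show ?thesis using conj1 conj2 conj3 conj4 by blast
  qed
  show ?thesis
    unfolding Let_def d_def[symmetric]
  proof (rule exI, rule conjI[OF C\<^sub>S(1)], intro allI impI, goal_cases)
    case (1 q)
    have pos: "2 * C\<^sub>E\<^sup>2 > 0" "c\<^sub>1 > 0" "1 / (real q)\<^sup>2 > 0" "C\<^sub>E > 0"
      using 1 by (simp_all add: C\<^sub>E_def c\<^sub>1_def)
    show ?case
      by (rule exI, rule conjI[OF pos(1)], rule exI, rule conjI[OF pos(2)],
          rule exI, rule conjI[OF pos(3)], rule exI, rule conjI[OF pos(4)], intro allI impI, elim conjE,
          rule main[OF 1 _ _ _ _ _ refl refl refl refl])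
  qed
qed

end
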